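(* Let $(M,g,Q,P)$ be a super-null Riemannian manifold. Then in Shander coordinates $(x^a,t,\tau)$ the most general form of the degenerate metric $g$ is $$g=\mathrm{d}x^a\otimes\mathrm{d}x^b\,g_{ba}(x,t)+2\,\mathrm{d}x^a\otimes\mathrm{d}t\,g_{ta}(x,t)-2\,\mathrm{d}x^a\otimes\mathrm{d}\tau\,\tau\,g_{ta}(x,t)-2\,\mathrm{d}t\otimes\mathrm{d}\tau\,\tau\,g_{tt}(x,t)+\mathrm{d}t\otimes\mathrm{d}t\,g_{tt}(x,t),$$ that is, the components $g_{ab}=g_{ba}$, $g_{ta}=g_{at}$, $g_{tt}$ are functions of $(x,t)$ only, and $g_{\tau a}=-\tau\,g_{ta}$, $g_{\tau t}=-\tau\,g_{tt}$, $g_{\tau\tau}=0$.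
   Context: Supermanifolds are real, finite-dimensional, in the Berezin–Leites (locally ringed space) sense, $M=(|M|,\mathcal{O}_M)$; $C^\infty(M)$ is the superalgebra of global functions, $\mathrm{Vect}(M)$ the $C^\infty(M)$-module of vector fields, $\widetilde{\cdot}$ denotes $\mathbb{Z}_2$-parity, and $[X,Y]=XY-(-1)^{\widetilde X\widetilde Y}YX$ is the graded commutator. A metric $g$ on $M$ is an even, graded-symmetric, rank 2 covariant tensor, possibly degenerate. In local coordinates $y^A$ it is written $g=\mathrm{d}y^A\otimes\mathrm{d}y^B\,g_{BA}(y)$ (summation convention), with $\mathrm{d}y^A$ assigned the parity $\widetilde A$ of $y^A$, $\widetilde{g_{BA}}=\widetilde A+\widetilde B$ and $g_{AB}=(-1)^{\widetilde A\widetilde B}g_{BA}$; for $A\neq B$ a term $2\,\mathrm{d}y^A\otimes\mathrm{d}y^B\,g_{BA}$ is shorthand for the sum of the two off-diagonal terms with indices $(A,B)$ and $(B,A)$. The associated pairing is $\langle X|Y\rangle=(-1)^{\widetilde Y\widetilde A}X^AY^Bg_{BA}$, so that $\langle\partial_A|\partial_B\rangle=g_{AB}$, and it satisfies $\langle X|Y\rangle=(-1)^{\widetilde X\widetilde Y}\langle Y|X\rangle$, $\langle fX+Y|Z\rangle=f\langle X|Z\rangle+\langle Y|Z\rangle$. The kernel is $\ker(g)=\{X\in\mathrm{Vect}(M) : \langle X|Y\rangle=0\ \text{for all } Y\in\mathrm{Vect}(M)\}$; $g$ is degenerate if $\ker(g)\neq\{0\}$. A super-null Riemannian manifold is a quadruple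 $(M,g,Q,P)$ where $M$ is a supermanifold of dimension $n|1$ ($n\ge 1$), $g$ is a degenerate (even) metric on $M$, $Q\in\mathrm{Vect}(M)$ is a non-singular odd vector field (i.e. its value in $T_mM$ is nonzero at every point $m\in|M|$) with $[Q,Q]=2P$ for an even vector field $P$, and $\ker(g)=\mathrm{Span}\{Q\}$ (the $C^\infty(M)$-span). It is part of the setting that the rank of the kernel is constant, equal to $0|1$ (at every point $m\in |M|$ the bilinear form induced by $g$ on $T_mM$ has kernel of dimension $0|1$), and that around every point of $|M|$ there are Shander coordinates $(x^a,t,\tau)$, with $x^a,t$ even and $\tau$ odd, in which $Q=\partial_\tau+\tau\partial_t$ and $P=\partial_t$. *)

theory Defs
  imports "HOL-Analysis.Analysis" "HOL-Algebra.Module" "HOL-Library.Z2"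
begin

section \<open>Superalgebras\<close>

text \<open>
  Parities are elements of \<open>\<int>/2\<close>, that is, of type \<^typ>\<open>bit\<close>.  The Koszul sign
  \<open>(-1)\<^sup>p\<^sup>q\<close> is a real number, so that it can act on a real superalgebra by scalar
  multiplication.
\<close>

definition koszul :: "bit \<Rightarrow> bit \<Rightarrow> real" where
  "koszul p q = (if p = 1 \<and> q = 1 then - 1 else 1)"

definition real_ring :: "real ring" where
  "real_ring = \<lparr>carrier = UNIV, mult = (*), one = 1, zero = 0, add = (+)\<rparr>"

definition superalgebra :: "(real, 'a) module \<Rightarrow> (bit \<Rightarrow> 'a set) \<Rightarrow> bool" where
  "superalgebra A G \<longleftrightarrow>
     ring A \<and> module real_ring A \<and>
     (\<forall>c. \<forall>x\<in>carrier A. \<forall>y\<in>carrier A.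
        (c \<odot>\<^bsub>A\<^esub> x) \<otimes>\<^bsub>A\<^esub> y = c \<odot>\<^bsub>A\<^esub> (x \<otimes>\<^bsub>A\<^esub> y) \<and>
        x \<otimes>\<^bsub>A\<^esub> (c \<odot>\<^bsub>A\<^esub> y) = c \<odot>\<^bsub>A\<^esub> (x \<otimes>\<^bsub>A\<^esub> y)) \<and>
     (\<forall>p. G p \<subseteq> carrier A \<and> \<zero>\<^bsub>A\<^esub> \<in> G p \<and>
        (\<forall>x\<in>G p. \<forall>y\<in>G p. x \<oplus>\<^bsub>A\<^esub> y \<in> G p) \<and> (\<forall>c. \<forall>x\<in>G p. c \<odot>\<^bsub>A\<^esub> x \<in> G p)) \<and>
     (\<forall>x\<in>carrier A. \<exists>!(x0, x1). x0 \<in> G 0 \<and> x1 \<in> G 1 \<and> x = x0 \<oplus>\<^bsub>A\<^esub> x1) \<and>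
     \<one>\<^bsub>A\<^esub> \<in> G 0 \<and>
     (\<forall>p q. \<forall>x\<in>G p. \<forall>y\<in>G q. x \<otimes>\<^bsub>A\<^esub> y \<in> G (p + q) \<and>
        x \<otimes>\<^bsub>A\<^esub> y = koszul p q \<odot>\<^bsub>A\<^esub> (y \<otimes>\<^bsub>A\<^esub> x))"

definition superalgebra_hom ::
    "(real, 'a) module \<Rightarrow> (bit \<Rightarrow> 'a set) \<Rightarrow> (real, 'b) module \<Rightarrow> (bit \<Rightarrow> 'b set) \<Rightarrow> ('a \<Rightarrow> 'b) \<Rightarrow> bool"
  where
  "superalgebra_hom A G B H h \<longleftrightarrow>
     h \<in> ring_hom A B \<and>
     (\<forall>c. \<forall>x\<in>carrier A. h (c \<odot>\<^bsub>A\<^esub> x) = c \<odot>\<^bsub>B\<^esub> h x) \<and>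
     (\<forall>p. h ` G p \<subseteq> H p)"


section \<open>Superspaces: sheaves of superalgebras\<close>

text \<open>
  The points of the underlying space \<open>|M|\<close> are all elements of the type \<open>'p\<close>; the
  superalgebras of functions on the various open sets are carried by subsets of one type \<open>'s\<close>.
\<close>

record ('p, 's) superspace =
  sections :: "'p set \<Rightarrow> (real, 's) module"
  graded :: "'p set \<Rightarrow> bit \<Rightarrow> 's set"
  restr :: "'p set \<Rightarrow> 'p set \<Rightarrow> 's \<Rightarrow> 's"

definition sheaf_of_superalgebras :: "('p::topological_space, 's) superspace \<Rightarrow> bool" where
  "sheaf_of_superalgebras M \<longleftrightarrow>
     (\<forall>U. open U \<longrightarrow> superalgebra (sections M U) (graded M U)) \<and>
     (\<forall>U V. open U \<and> open V \<and> V \<subseteq> U \<longrightarrow>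
        superalgebra_hom (sections M U) (graded M U) (sections M V) (graded M V) (restr M U V)) \<and>
     (\<forall>U. open U \<longrightarrow> (\<forall>s\<in>carrier (sections M U). restr M U U s = s)) \<and>
     (\<forall>U V W. open U \<and> open V \<and> open W \<and> W \<subseteq> V \<and> V \<subseteq> U \<longrightarrow>
        (\<forall>s\<in>carrier (sections M U). restr M V W (restr M U V s) = restr M U W s)) \<and>
     (\<forall>C. (\<forall>V\<in>C. open V) \<longrightarrow>
        (\<forall>s. (\<forall>V\<in>C. s V \<in> carrier (sections M V)) \<and>
             (\<forall>V\<in>C. \<forall>W\<in>C. restr M V (V \<inter> W) (s V) = restr M W (V \<inter> W) (s W)) \<longrightarrow>
             (\<exists>!t. t \<in> carrier (sections M (\<Union>C)) \<and> (\<forall>V\<in>C. restr M (\<Union>C) V t = s V))))"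


section \<open>The local model of dimension $n|1$\<close>

primrec C_k_on :: "nat \<Rightarrow> (real^'n) set \<Rightarrow> (real^'n \<Rightarrow> real) \<Rightarrow> bool" where
  "C_k_on 0 W f \<longleftrightarrow> continuous_on W f"
| "C_k_on (Suc k) W f \<longleftrightarrow>
     f differentiable_on W \<and> (\<forall>i. C_k_on k W (\<lambda>x. frechet_derivative f (at x) (axis i 1)))"

text \<open>Functions on \<open>W\<close> are represented by functions on \<open>\<real>\<^sup>n\<close> that vanish outside \<open>W\<close>.\<close>

definition smooth_functions :: "(real^'n) set \<Rightarrow> (real^'n \<Rightarrow> real) set" where
  "smooth_functions W = {f. (\<forall>k. C_k_on k W f) \<and> (\<forall>x. x \<notin> W \<longrightarrow> f x = 0)}"

text \<open>
  The superalgebra \<open>C\<^sup>\<infinity>(W) \<otimes> \<Lambda>[\<tau>]\<close>: the pair \<open>(f0, f1)\<close> stands for \<open>f0 + \<tau> f1\<close>.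
\<close>

type_synonym 'n model_fun = "(real^'n \<Rightarrow> real) \<times> (real^'n \<Rightarrow> real)"

definition model :: "(real^'n) set \<Rightarrow> (real, 'n model_fun) module" where
  "model W =
     \<lparr>carrier = smooth_functions W \<times> smooth_functions W,
      mult = (\<lambda>(f0, f1) (g0, g1). (\<lambda>x. f0 x * g0 x, \<lambda>x. f1 x * g0 x + f0 x * g1 x)),
      one = (\<lambda>x. if x \<in> W then 1 else 0, \<lambda>x. 0),
      zero = (\<lambda>x. 0, \<lambda>x. 0),
      add = (\<lambda>(f0, f1) (g0, g1). (\<lambda>x. f0 x + g0 x, \<lambda>x. f1 x + g1 x)),
      smult = (\<lambda>c (f0, f1). (\<lambda>x. c * f0 x, \<lambda>x. c * f1 x))\<rparr>"

definition model_graded :: "(real^'n) set \<Rightarrow> bit \<Rightarrow> 'n model_fun set" where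
  "model_graded W p =
     (if p = 0 then smooth_functions W \<times> {\<lambda>x. 0} else {\<lambda>x. 0} \<times> smooth_functions W)"

definition model_restr :: "(real^'n) set \<Rightarrow> 'n model_fun \<Rightarrow> 'n model_fun" where
  "model_restr W = (\<lambda>(f0, f1). (\<lambda>x. if x \<in> W then f0 x else 0, \<lambda>x. if x \<in> W then f1 x else 0))"

text \<open>
  Coordinate indices: \<open>Some i\<close> is the \<open>i\<close>-th even coordinate and \<open>None\<close> is the odd coordinate
  \<open>\<tau>\<close>.  Odd derivatives act from the left.
\<close>

definition idx_parity :: "'n option \<Rightarrow> bit" where
  "idx_parity A = (case A of None \<Rightarrow> 1 | Some i \<Rightarrow> 0)"

definition model_coord :: "(real^'n) set \<Rightarrow> 'n option \<Rightarrow> 'n model_fun" where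
  "model_coord W A =
     (case A of
        Some i \<Rightarrow> (\<lambda>x. if x \<in> W then x $ i else 0, \<lambda>x. 0)
      | None \<Rightarrow> (\<lambda>x. 0, \<lambda>x. if x \<in> W then 1 else 0))"

definition partial_on :: "(real^'n) set \<Rightarrow> 'n \<Rightarrow> (real^'n \<Rightarrow> real) \<Rightarrow> real^'n \<Rightarrow> real" where
  "partial_on W i f = (\<lambda>x. if x \<in> W then frechet_derivative f (at x) (axis i 1) else 0)"

definition model_deriv :: "(real^'n) set \<Rightarrow> 'n option \<Rightarrow> 'n model_fun \<Rightarrow> 'n model_fun" where
  "model_deriv W A =
     (\<lambda>(f0, f1). case A of
        Some i \<Rightarrow> (partial_on W i f0, partial_on W i f1)
      | None \<Rightarrow> (f1, \<lambda>x. 0))"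


section \<open>Charts and supermanifolds\<close>

text \<open>
  A chart is an isomorphism of an open sub-superspace with a superdomain: a homeomorphism of the
  underlying spaces together with the pullbacks of functions on the open subsets \<open>W\<close> of its range.
\<close>

record ('p, 's, 'n) chart =
  chart_dom :: "'p set"
  chart_map :: "'p \<Rightarrow> real^'n"
  pullback :: "(real^'n) set \<Rightarrow> 'n model_fun \<Rightarrow> 's"

definition chart_range :: "('p, 's, 'n::finite) chart \<Rightarrow> (real^'n) set" where
  "chart_range c = chart_map c ` chart_dom c"

definition chart_preimage :: "('p, 's, 'n::finite) chart \<Rightarrow> (real^'n) set \<Rightarrow> 'p set" where
  "chart_preimage c W = {m \<in> chart_dom c. chart_map c m \<in> W}"

definition is_chart :: "('p::topological_space, 's) superspace \<Rightarrow> ('p, 's, 'n::finite) chart \<Rightarrow> bool"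
  where
  "is_chart M c \<longleftrightarrow>
     open (chart_dom c) \<and> open (chart_range c) \<and>
     (\<exists>\<psi>. homeomorphism (chart_dom c) (chart_range c) (chart_map c) \<psi>) \<and>
     (\<forall>W. open W \<and> W \<subseteq> chart_range c \<longrightarrow>
        bij_betw (pullback c W) (carrier (model W)) (carrier (sections M (chart_preimage c W))) \<and>
        superalgebra_hom (model W) (model_graded W)
          (sections M (chart_preimage c W)) (graded M (chart_preimage c W)) (pullback c W)) \<and>
     (\<forall>W W'. open W \<and> open W' \<and> W' \<subseteq> W \<and> W \<subseteq> chart_range c \<longrightarrow>
        (\<forall>f\<in>carrier (model W).
           restr M (chart_preimage c W) (chart_preimage c W') (pullback c W f) =
           pullback c W' (model_restr W' f)))"

text \<open>
  Supermanifolds of dimension $n|1$, with \<open>n = CARD('n) \<ge> 1\<close>.  The stalks are local rings because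
  the local models have this property.
\<close>

definition supermanifold ::
    "'n::finite itself \<Rightarrow> ('p::{t2_space, second_countable_topology}, 's) superspace \<Rightarrow> bool" where
  "supermanifold _ M \<longleftrightarrow>
     sheaf_of_superalgebras M \<and>
     (\<forall>m. \<exists>c :: ('p, 's, 'n) chart. is_chart M c \<and> m \<in> chart_dom c)"

definition coord :: "('p, 's, 'n::finite) chart \<Rightarrow> 'n option \<Rightarrow> 's" where
  "coord c A = pullback c (chart_range c) (model_coord (chart_range c) A)"

text \<open>The functions on the chart domain that depend on the even coordinates only:\<close>

definition even_coord_fun :: "('p, 's, 'n::finite) chart \<Rightarrow> 's \<Rightarrow> bool" where
  "even_coord_fun c s \<longleftrightarrow>
     (\<exists>f\<in>smooth_functions (chart_range c). s = pullback c (chart_range c) (f, \<lambda>x. 0))"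


section \<open>Vector fields\<close>

text \<open>
  A vector field on \<open>U\<close> is a derivation of the sheaf of functions restricted to \<open>U\<close>, that is, a
  family of derivations \<open>X V\<close> of the superalgebras on the open sets \<open>V \<subseteq> U\<close> that commutes with
  restrictions.  Outside its domain the family is normalised to \<^const>\<open>undefined\<close>, so that
  equality of vector fields is equality of families.
\<close>

type_synonym ('p, 's) vfield = "'p set \<Rightarrow> 's \<Rightarrow> 's"

definition vf_normalise ::
    "('p::topological_space, 's) superspace \<Rightarrow> 'p set \<Rightarrow> ('p, 's) vfield \<Rightarrow> ('p, 's) vfield" where
  "vf_normalise M U X =
     (\<lambda>V f. if open V \<and> V \<subseteq> U \<and> f \<in> carrier (sections M V) then X V f else undefined)"

definition vect_hom :: "('p::topological_space, 's) superspace \<Rightarrow> 'p set \<Rightarrow> bit \<Rightarrow> ('p, 's) vfield set"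
  where
  "vect_hom M U p = {X.
     X = vf_normalise M U X \<and>
     (\<forall>V. open V \<and> V \<subseteq> U \<longrightarrow>
        (\<forall>q. \<forall>f\<in>graded M V q. X V f \<in> graded M V (p + q)) \<and>
        (\<forall>f\<in>carrier (sections M V). \<forall>h\<in>carrier (sections M V).
           X V (f \<oplus>\<^bsub>sections M V\<^esub> h) = X V f \<oplus>\<^bsub>sections M V\<^esub> X V h) \<and>
        (\<forall>a. \<forall>f\<in>carrier (sections M V).
           X V (a \<odot>\<^bsub>sections M V\<^esub> f) = a \<odot>\<^bsub>sections M V\<^esub> X V f) \<and>
        (\<forall>q. \<forall>f\<in>graded M V q. \<forall>h\<in>carrier (sections M V).
           X V (f \<otimes>\<^bsub>sections M V\<^esub> h) =
             (X V f \<otimes>\<^bsub>sections M V\<^esub> h) \<oplus>\<^bsub>sections M V\<^esub>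
             (koszul p q \<odot>\<^bsub>sections M V\<^esub> (f \<otimes>\<^bsub>sections M V\<^esub> X V h)))) \<and>
     (\<forall>V W. open V \<and> open W \<and> W \<subseteq> V \<and> V \<subseteq> U \<longrightarrow>
        (\<forall>f\<in>carrier (sections M V). restr M V W (X V f) = X W (restr M V W f)))}"

definition vf_zero :: "('p::topological_space, 's) superspace \<Rightarrow> 'p set \<Rightarrow> ('p, 's) vfield" where
  "vf_zero M U = vf_normalise M U (\<lambda>V f. \<zero>\<^bsub>sections M V\<^esub>)"

definition vf_add ::
    "('p::topological_space, 's) superspace \<Rightarrow> 'p set \<Rightarrow>
     ('p, 's) vfield \<Rightarrow> ('p, 's) vfield \<Rightarrow> ('p, 's) vfield" where
  "vf_add M U X Y = vf_normalise M U (\<lambda>V f. X V f \<oplus>\<^bsub>sections M V\<^esub> Y V f)"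

definition vf_smult ::
    "('p::topological_space, 's) superspace \<Rightarrow> 'p set \<Rightarrow> 's \<Rightarrow> ('p, 's) vfield \<Rightarrow> ('p, 's) vfield" where
  "vf_smult M U h X = vf_normalise M U (\<lambda>V f. restr M U V h \<otimes>\<^bsub>sections M V\<^esub> X V f)"

definition vf_scale ::
    "('p::topological_space, 's) superspace \<Rightarrow> 'p set \<Rightarrow> real \<Rightarrow> ('p, 's) vfield \<Rightarrow> ('p, 's) vfield" where
  "vf_scale M U a X = vf_normalise M U (\<lambda>V f. a \<odot>\<^bsub>sections M V\<^esub> X V f)"

text \<open>The graded commutator of vector fields of parities \<open>p\<close> and \<open>q\<close>:\<close>

definition vf_bracket ::
    "('p::topological_space, 's) superspace \<Rightarrow> 'p set \<Rightarrow> bit \<Rightarrow> bit \<Rightarrow>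
     ('p, 's) vfield \<Rightarrow> ('p, 's) vfield \<Rightarrow> ('p, 's) vfield" where
  "vf_bracket M U p q X Y = vf_normalise M U (\<lambda>V f.
     X V (Y V f) \<ominus>\<^bsub>sections M V\<^esub> (koszul p q \<odot>\<^bsub>sections M V\<^esub> Y V (X V f)))"

definition vect :: "('p::topological_space, 's) superspace \<Rightarrow> 'p set \<Rightarrow> ('p, 's) vfield set" where
  "vect M U = {vf_add M U X0 X1 | X0 X1. X0 \<in> vect_hom M U 0 \<and> X1 \<in> vect_hom M U 1}"

definition coord_vf ::
    "('p::topological_space, 's) superspace \<Rightarrow> ('p, 's, 'n::finite) chart \<Rightarrow> 'n option \<Rightarrow> ('p, 's) vfield"
  where
  "coord_vf M c A = vf_normalise M (chart_dom c) (\<lambda>V f.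
     let W = chart_map c ` V in
       pullback c W (model_deriv W A (inv_into (carrier (model W)) (pullback c W) f)))"


section \<open>Values and tangent vectors at a point\<close>

text \<open>
  The value of a function \<open>f\<close> at \<open>m\<close> is the unique real number \<open>r\<close> such that \<open>f - r\<close> is not
  invertible in any neighbourhood of \<open>m\<close>.
\<close>

definition value_at :: "('p::topological_space, 's) superspace \<Rightarrow> 'p \<Rightarrow> 'p set \<Rightarrow> 's \<Rightarrow> real" where
  "value_at M m U f = (THE r. \<forall>V. open V \<and> m \<in> V \<and> V \<subseteq> U \<longrightarrow>
     restr M U V f \<ominus>\<^bsub>sections M V\<^esub> (r \<odot>\<^bsub>sections M V\<^esub> \<one>\<^bsub>sections M V\<^esub>) \<notin> Units (sections M V))"

text \<open>
  Tangent vectors of parity \<open>p\<close> at \<open>m\<close> are derivations of the stalk at \<open>m\<close>, given as compatible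
  families of functionals on the functions on open neighbourhoods of \<open>m\<close>.  No sign is needed in
  the Leibniz rule, since odd functions have value \<open>0\<close>.
\<close>

definition tangent_hom :: "('p::topological_space, 's) superspace \<Rightarrow> 'p \<Rightarrow> bit \<Rightarrow> ('p set \<Rightarrow> 's \<Rightarrow> real) set"
  where
  "tangent_hom M m p = {v.
     (\<forall>U f. \<not> (open U \<and> m \<in> U \<and> f \<in> carrier (sections M U)) \<longrightarrow> v U f = 0) \<and>
     (\<forall>U. open U \<and> m \<in> U \<longrightarrow>
        (\<forall>f\<in>carrier (sections M U). \<forall>h\<in>carrier (sections M U).
           v U (f \<oplus>\<^bsub>sections M U\<^esub> h) = v U f + v U h \<and>
           v U (f \<otimes>\<^bsub>sections M U\<^esub> h) = v U f * value_at M m U h + value_at M m U f * v U h) \<and>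
        (\<forall>a. \<forall>f\<in>carrier (sections M U). v U (a \<odot>\<^bsub>sections M U\<^esub> f) = a * v U f) \<and>
        (\<forall>q. q \<noteq> p \<longrightarrow> (\<forall>f\<in>graded M U q. v U f = 0))) \<and>
     (\<forall>U V. open U \<and> open V \<and> m \<in> V \<and> V \<subseteq> U \<longrightarrow>
        (\<forall>f\<in>carrier (sections M U). v V (restr M U V f) = v U f))}"

text \<open>The value at \<open>m\<close> of a vector field \<open>X\<close> on \<open>W\<close>:\<close>

definition vf_at ::
    "('p::topological_space, 's) superspace \<Rightarrow> 'p set \<Rightarrow> ('p, 's) vfield \<Rightarrow> 'p \<Rightarrow> 'p set \<Rightarrow> 's \<Rightarrow> real"
  where
  "vf_at M W X m = (\<lambda>U f.
     if open U \<and> m \<in> U \<and> f \<in> carrier (sections M U)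
     then value_at M m (U \<inter> W) (X (U \<inter> W) (restr M U (U \<inter> W) f)) else 0)"

definition nonsingular :: "('p::topological_space, 's) superspace \<Rightarrow> ('p, 's) vfield \<Rightarrow> bool" where
  "nonsingular M X \<longleftrightarrow> (\<forall>m. vf_at M UNIV X m \<noteq> (\<lambda>U f. 0))"


section \<open>Metrics\<close>

text \<open>
  A metric is given by its pairings \<open>g U X Y = \<langle>X|Y\<rangle>\<close> of vector fields on the open sets \<open>U\<close>.
  For components \<open>h A B = g\<^sub>A\<^sub>B\<close>, the predicate \<open>tensor_form\<close> expresses
  \<open>g = dy\<^sup>A \<otimes> dy\<^sup>B g\<^sub>B\<^sub>A\<close> in terms of the associated pairing
  \<open>\<langle>X|Y\<rangle> = (-1)\<^sup>Y\<^sup>A X\<^sup>A Y\<^sup>B g\<^sub>B\<^sub>A\<close>, where \<open>X\<^sup>A = X(y\<^sup>A)\<close>.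
\<close>

type_synonym ('p, 's) pairing = "'p set \<Rightarrow> ('p, 's) vfield \<Rightarrow> ('p, 's) vfield \<Rightarrow> 's"

definition tensor_form ::
    "('p::topological_space, 's) superspace \<Rightarrow> ('p, 's) pairing \<Rightarrow> ('p, 's, 'n::finite) chart \<Rightarrow>
     ('n option \<Rightarrow> 'n option \<Rightarrow> 's) \<Rightarrow> bool" where
  "tensor_form M g c h \<longleftrightarrow>
     (let U = chart_dom c; R = sections M U in
       \<forall>q. \<forall>X\<in>vect M U. \<forall>Y\<in>vect_hom M U q.
         g U X Y = (\<Oplus>\<^bsub>R\<^esub>A\<in>UNIV. \<Oplus>\<^bsub>R\<^esub>B\<in>UNIV.
            koszul q (idx_parity A) \<odot>\<^bsub>R\<^esub>
              (X U (coord c A) \<otimes>\<^bsub>R\<^esub> Y U (coord c B) \<otimes>\<^bsub>R\<^esub> h B A)))"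

definition metric_components ::
    "('p::topological_space, 's) superspace \<Rightarrow> ('p, 's, 'n::finite) chart \<Rightarrow>
     ('n option \<Rightarrow> 'n option \<Rightarrow> 's) \<Rightarrow> bool" where
  "metric_components M c h \<longleftrightarrow>
     (\<forall>A B. h A B \<in> graded M (chart_dom c) (idx_parity A + idx_parity B) \<and>
        h A B = koszul (idx_parity A) (idx_parity B) \<odot>\<^bsub>sections M (chart_dom c)\<^esub> h B A)"

text \<open>
  The formula in \<open>tensor_form\<close> is for homogeneous \<open>Y\<close>; additivity extends it to all \<open>Y\<close>.
  Evenness, graded symmetry and linearity over functions of the pairing follow from the local form.
\<close>

definition metric ::
    "'n::finite itself \<Rightarrow> ('p::topological_space, 's) superspace \<Rightarrow> ('p, 's) pairing \<Rightarrow> bool" where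
  "metric _ M g \<longleftrightarrow>
     (\<forall>U. open U \<longrightarrow> (\<forall>X\<in>vect M U. \<forall>Y\<in>vect M U.
        g U X Y \<in> carrier (sections M U) \<and>
        (\<forall>Z\<in>vect M U. g U X (vf_add M U Y Z) = g U X Y \<oplus>\<^bsub>sections M U\<^esub> g U X Z) \<and>
        (\<forall>V. open V \<and> V \<subseteq> U \<longrightarrow>
           restr M U V (g U X Y) = g V (vf_normalise M V X) (vf_normalise M V Y)))) \<and>
     (\<forall>c :: ('p, 's, 'n) chart. is_chart M c \<longrightarrow>
        (\<exists>h. metric_components M c h \<and> tensor_form M g c h))"

text \<open>The components \<open>g\<^sub>A\<^sub>B = \<langle>\<partial>\<^sub>A|\<partial>\<^sub>B\<rangle>\<close> in a chart:\<close>

definition component ::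
    "('p::topological_space, 's) superspace \<Rightarrow> ('p, 's) pairing \<Rightarrow> ('p, 's, 'n::finite) chart \<Rightarrow>
     'n option \<Rightarrow> 'n option \<Rightarrow> 's" where
  "component M g c A B = g (chart_dom c) (coord_vf M c A) (coord_vf M c B)"

definition metric_kernel :: "('p::topological_space, 's) superspace \<Rightarrow> ('p, 's) pairing \<Rightarrow> ('p, 's) vfield set"
  where
  "metric_kernel M g =
     {X \<in> vect M UNIV. \<forall>Y\<in>vect M UNIV. g UNIV X Y = \<zero>\<^bsub>sections M UNIV\<^esub>}"

definition degenerate :: "('p::topological_space, 's) superspace \<Rightarrow> ('p, 's) pairing \<Rightarrow> bool" where
  "degenerate M g \<longleftrightarrow> metric_kernel M g \<noteq> {vf_zero M UNIV}"

text \<open>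
  The kernel of the bilinear form on the tangent space at \<open>m\<close> induced by \<open>g\<close>.  Every tangent
  vector at \<open>m\<close> is the value of a vector field \<open>X\<close> defined near \<open>m\<close>.
\<close>

definition kernel_at ::
    "('p::topological_space, 's) superspace \<Rightarrow> ('p, 's) pairing \<Rightarrow> 'p \<Rightarrow> ('p set \<Rightarrow> 's \<Rightarrow> real) set" where
  "kernel_at M g m = {v. \<exists>W X. open W \<and> m \<in> W \<and> X \<in> vect M W \<and> v = vf_at M W X m \<and>
     (\<forall>Y\<in>vect M W. value_at M m W (g W X Y) = 0)}"

definition kernel_rank_0_1 :: "('p::topological_space, 's) superspace \<Rightarrow> ('p, 's) pairing \<Rightarrow> bool" where
  "kernel_rank_0_1 M g \<longleftrightarrow>
     (\<forall>m. \<exists>w\<in>tangent_hom M m 1. w \<noteq> (\<lambda>U f. 0) \<and>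
        kernel_at M g m = {(\<lambda>U f. a * w U f) | a :: real. True})"


section \<open>Super-null Riemannian manifolds\<close>

text \<open>
  Shander coordinates: \<open>t\<close> is the distinguished even index, and the remaining even indices are
  those of the coordinates \<open>x\<^sup>a\<close> (there are none if \<open>n = 1\<close>).
\<close>

definition shander_chart ::
    "('p::topological_space, 's) superspace \<Rightarrow> ('p, 's) vfield \<Rightarrow> ('p, 's) vfield \<Rightarrow>
     ('p, 's, 'n::finite) chart \<Rightarrow> 'n \<Rightarrow> bool" where
  "shander_chart M Q P c t \<longleftrightarrow>
     is_chart M c \<and>
     vf_normalise M (chart_dom c) Q =
       vf_add M (chart_dom c) (coord_vf M c None)
         (vf_smult M (chart_dom c) (coord c None) (coord_vf M c (Some t))) \<and>
     vf_normalise M (chart_dom c) P = coord_vf M c (Some t)"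

definition super_null_riemannian ::
    "'n::finite itself \<Rightarrow> ('p::{t2_space, second_countable_topology}, 's) superspace \<Rightarrow>
     ('p, 's) pairing \<Rightarrow> ('p, 's) vfield \<Rightarrow> ('p, 's) vfield \<Rightarrow> bool" where
  "super_null_riemannian n M g Q P \<longleftrightarrow>
     supermanifold n M \<and>
     metric n M g \<and> degenerate M g \<and>
     Q \<in> vect_hom M UNIV 1 \<and> nonsingular M Q \<and>
     P \<in> vect_hom M UNIV 0 \<and> vf_bracket M UNIV 1 1 Q Q = vf_scale M UNIV 2 P \<and>
     metric_kernel M g = {vf_smult M UNIV f Q | f. f \<in> carrier (sections M UNIV)} \<and>
     kernel_rank_0_1 M g \<and>
     (\<forall>m. \<exists>(c :: ('p, 's, 'n) chart) t. shander_chart M Q P c t \<and> m \<in> chart_dom c)"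

end

theory Submission
  imports Defs
begin

text \<open>
  Write \<open>g\<^sub>A\<^sub>B\<close> for the components in a Shander chart.  Since \<open>Q = \<partial>\<^sub>\<tau> + \<tau> \<partial>\<^sub>t\<close> spans the kernel,
  \<open>0 = \<langle>Q|\<partial>\<^sub>B\<rangle> = g\<^sub>\<tau>\<^sub>B + \<tau> g\<^sub>t\<^sub>B\<close>, which gives \<open>g\<^sub>\<tau>\<^sub>a = - \<tau> g\<^sub>t\<^sub>a\<close> and \<open>g\<^sub>\<tau>\<^sub>t = - \<tau> g\<^sub>t\<^sub>t\<close>; graded symmetry
  gives \<open>g\<^sub>\<tau>\<^sub>\<tau> = 0\<close>, and evenness of \<open>g\<close> makes the components with two even indices independent of
  \<open>\<tau>\<close>.  The kernel is a condition on global vector fields, whereas \<open>\<partial>\<^sub>B\<close> lives on the chart only: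
  one pairs \<open>Q\<close> with \<open>\<rho> \<partial>\<^sub>B\<close> extended by zero, for bump functions \<open>\<rho>\<close> supported in the chart.
\<close>

section \<open>Smooth functions and bump functions\<close>

text \<open>The obstacle is the passage from the global kernel condition to the local components. A
  field \<rho> \<partial>_B on the chart extends by zero only if \<rho> vanishes off a subset of the
  chart domain that is closed in the whole space. This is why the bumps come with a compact set: its
  image in M is compact, hence closed, since the space is Hausdorff. The extension has to be built
  on the sections over every open set V, by gluing the given field over the part of V in the chart
  with 0 over the part of V off the support. Restricting the global pairing to the chart gives
  \<rho> S_B = 0, where S_B is the relation sought for the index B. A compactly supported \<rho>
  cannot be nonzero on a whole nonempty chart, so S_B = 0 is concluded point by point, each point
  having its own bump. Independence of \<tau> rests on there being only one odd coordinate: an even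
  function has no \<tau>-term. The step to g_\<tau>\<tau> = 0 divides by 2, which real scalars
  allow.\<close>

lemma frechet_derivative_cong_open:
  assumes "open W" "x \<in> W" "\<And>y. y \<in> W \<Longrightarrow> f y = g y"
  shows "frechet_derivative f (at x) = frechet_derivative g (at x)"
proof -
  \<comment> \<open>\<open>frechet_derivative\<close> is a choice among the derivatives at the
    point. Once \<open>f\<close> and \<open>g\<close> have the same derivatives the two choices
    coincide, whether or not a derivative exists.\<close>
  have "(f has_derivative D) (at x) \<longleftrightarrow> (g has_derivative D) (at x)" for D
    using has_derivative_transform_within_open[OF _ assms(1,2)] assms(3) by metis
  then show ?thesis by (simp add: frechet_derivative_def)
qed

lemma C_k_on_cong:
  assumes "open W" "\<And>x. x \<in> W \<Longrightarrow> f x = g x"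
  shows "C_k_on k W f \<longleftrightarrow> C_k_on k W g"
  using assms(2)
proof (induction k arbitrary: f g)
  case 0
  then show ?case by (simp cong: continuous_on_cong)
next
  case (Suc k)
  have "C_k_on k W (\<lambda>x. frechet_derivative f (at x) (axis i 1)) \<longleftrightarrow>
      C_k_on k W (\<lambda>x. frechet_derivative g (at x) (axis i 1))" for i
    by (rule Suc.IH) (metis frechet_derivative_cong_open[OF assms(1)] Suc.prems)
  moreover have "f differentiable_on W \<longleftrightarrow> g differentiable_on W"
    using Suc.prems unfolding differentiable_on_def
    by (metis differentiable_transform_within zero_less_one)
  ultimately show ?case by simp
qed

lemma C_k_on_SucD: "C_k_on (Suc k) W f \<Longrightarrow> C_k_on k W f"
  by (induction k arbitrary: f) (auto simp: differentiable_imp_continuous_on)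

lemma C_k_on_subset: "C_k_on k W f \<Longrightarrow> W' \<subseteq> W \<Longrightarrow> C_k_on k W' f"
  by (induction k arbitrary: f)
    (auto intro: continuous_on_subset differentiable_on_subset)

lemma C_k_on_const: "C_k_on k W (\<lambda>x. a)"
  by (induction k arbitrary: a) (simp_all add: frechet_derivative_const)

text \<open>The induction step for the closure properties below. By uniqueness
  \<open>frechet_derivative\<close> equals any explicit derivative \<open>D\<close> on
  \<open>W\<close>, and \<open>C_k_on\<close> on an open set sees only the values there, so the
  components of \<open>D\<close> may be examined instead.\<close>

lemma C_k_on_Suc_derivI:
  assumes "open W"
    and D: "\<And>x. x \<in> W \<Longrightarrow> (f has_derivative D x) (at x)"
    and C: "\<And>i. C_k_on k W (\<lambda>x. D x (axis i 1))"
  shows "C_k_on (Suc k) W f"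
proof -
  have "frechet_derivative f (at x) = D x" if "x \<in> W" for x
    using D[OF that] by (metis frechet_derivative_at)
  then have "C_k_on k W (\<lambda>x. frechet_derivative f (at x) (axis i 1))" for i
    using C[of i] C_k_on_cong[OF assms(1), of "\<lambda>x. frechet_derivative f (at x) (axis i 1)"
        "\<lambda>x. D x (axis i 1)" k] by simp
  moreover have "f differentiable_on W"
    using D by (auto simp: differentiable_on_def intro: differentiableI differentiable_at_withinI)
  ultimately show ?thesis by simp
qed

lemma C_k_on_Suc_has_derivative:
  assumes "open W" "C_k_on (Suc k) W f" "x \<in> W"
  shows "(f has_derivative frechet_derivative f (at x)) (at x)"
  using assms by (auto simp: differentiable_on_eq_differentiable_at frechet_derivative_works)

lemma C_k_on_add:
  assumes "open W" "C_k_on k W f" "C_k_on k W g"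
  shows "C_k_on k W (\<lambda>x. f x + g x)"
  using assms(2,3)
proof (induction k arbitrary: f g)
  case 0
  then show ?case by (simp add: continuous_on_add)
next
  case (Suc k)
  note D = C_k_on_Suc_has_derivative[OF assms(1)]
  show ?case
  proof (rule C_k_on_Suc_derivI[OF assms(1)])
    show "((\<lambda>x. f x + g x) has_derivative
        (\<lambda>v. frechet_derivative f (at x) v + frechet_derivative g (at x) v)) (at x)" if "x \<in> W" for x
      using D[OF Suc.prems(1) that] D[OF Suc.prems(2) that] by (rule has_derivative_add)
  qed (use Suc in simp)
qed

lemma C_k_on_mult:
  assumes "open W" "C_k_on k W f" "C_k_on k W g"
  shows "C_k_on k W (\<lambda>x. f x * g x)"
  using assms(2,3)
proof (induction k arbitrary: f g)
  case 0
  then show ?case by (simp add: continuous_on_mult)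
next
  case (Suc k)
  note D = C_k_on_Suc_has_derivative[OF assms(1)]
  show ?case
  proof (rule C_k_on_Suc_derivI[OF assms(1)])
    show "((\<lambda>x. f x * g x) has_derivative
        (\<lambda>v. f x * frechet_derivative g (at x) v + frechet_derivative f (at x) v * g x)) (at x)"
      if "x \<in> W" for x
      using D[OF Suc.prems(1) that] D[OF Suc.prems(2) that] by (rule has_derivative_mult)
    \<comment> \<open>Each Leibniz term pairs a derivative, which is only C^k, with an
      undifferentiated factor, which \<open>C_k_on_SucD\<close> lowers to the same order.\<close>
    show "C_k_on k W (\<lambda>x. f x * frechet_derivative g (at x) (axis i 1) +
        frechet_derivative f (at x) (axis i 1) * g x)" for i
      using Suc.prems by (intro C_k_on_add assms(1) Suc.IH) (auto dest: C_k_on_SucD simp del: C_k_on.simps, auto)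
  qed
qed

lemma C_k_on_cmult: "open W \<Longrightarrow> C_k_on k W f \<Longrightarrow> C_k_on k W (\<lambda>x. a * f x)"
  by (rule C_k_on_mult[OF _ C_k_on_const])

lemma C_k_on_vec_nth: "open W \<Longrightarrow> C_k_on k W (\<lambda>x. x $ i)"
proof (cases k)
  case (Suc l)
  assume "open W"
  then show ?thesis unfolding Suc
    by (rule C_k_on_Suc_derivI) (auto intro!: derivative_eq_intros C_k_on_const bounded_linear_imp_has_derivative bounded_linear_vec_nth)
qed (auto intro!: continuous_intros)

text \<open>
  The functions \<open>exp (- 1 / s) / s ^ j\<close>, continued by \<open>0\<close>: their span is closed under differentiation,
  so that all of them are smooth.
\<close>

definition exp_inv :: "nat \<Rightarrow> real \<Rightarrow> real" where
  "exp_inv j s = (if s > 0 then exp (- 1 / s) / s ^ j else 0)"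

text \<open>From the right, the substitution s = 1/u turns the claim into the limit of u^j / exp u
  at infinity; from the left the function is constantly 0.\<close>

lemma exp_inv_tendsto_0: "(exp_inv j \<longlongrightarrow> 0) (at 0)"
proof -
  have "((\<lambda>u. exp_inv j (inverse u)) \<longlongrightarrow> 0) at_top"
  proof (rule Lim_transform_eventually[OF tendsto_power_div_exp_0[of j]])
    show "\<forall>\<^sub>F u in at_top. u ^ j / exp u = exp_inv j (inverse u)"
      using eventually_gt_at_top[of 0]
      by eventually_elim (simp add: exp_inv_def field_simps exp_minus power_inverse)
  qed
  then have "(exp_inv j \<longlongrightarrow> 0) (at_right 0)"
    by (simp add: filterlim_at_right_to_top)
  moreover have "(exp_inv j \<longlongrightarrow> 0) (at_left 0)"
    by (rule Lim_transform_eventually[OF tendsto_const])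
      (auto simp: exp_inv_def eventually_at_filter)
  ultimately show ?thesis by (simp add: filterlim_split_at)
qed

lemma exp_inv_deriv:
  "(exp_inv j has_real_derivative exp_inv (j + 2) s - real j * exp_inv (j + 1) s) (at s)"
proof -
  consider "s > 0" | "s < 0" | "s = 0" by linarith
  then show ?thesis
  proof cases
    case 1
    have "((\<lambda>s. exp (- 1 / s)) has_real_derivative exp (- 1 / s) / s\<^sup>2) (at s)"
      using 1 by (auto intro!: derivative_eq_intros simp: power2_eq_square)
    from DERIV_divide[OF this DERIV_pow[of j s UNIV]]
    have "((\<lambda>s. exp (- 1 / s) / s ^ j) has_real_derivative
        exp_inv (j + 2) s - real j * exp_inv (j + 1) s) (at s)"
      \<comment> \<open>The power rule produces the exponent j - 1 with truncated subtraction, hence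
        the case split on \<open>j\<close>.\<close>
      by (rule back_subst[where P = "\<lambda>d. (_ has_real_derivative d) (at s)"])
        (use 1 in \<open>cases j; simp add: exp_inv_def field_simps power2_eq_square\<close>)+
    then show ?thesis
      by (rule has_field_derivative_transform_within_open[of _ _ _ "{0<..}"])
        (use 1 in \<open>auto simp: exp_inv_def\<close>)
  next
    case 2
    have "((\<lambda>s. 0) has_real_derivative exp_inv (j + 2) s - real j * exp_inv (j + 1) s) (at s)"
      using 2 by (simp add: exp_inv_def)
    then show ?thesis
      by (rule has_field_derivative_transform_within_open[of _ _ _ "{..<0}"])
        (use 2 in \<open>auto simp: exp_inv_def\<close>)
  next
    case 3
    \<comment> \<open>The difference quotient at 0 is again a member of the family, with
      \<open>j\<close> raised by one, and so tends to 0. The claimed derivative has the value 0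
      there too.\<close>
    have "((\<lambda>h. exp_inv j h / h) \<longlongrightarrow> 0) (at 0)"
      by (rule Lim_transform_eventually[OF exp_inv_tendsto_0[of "Suc j"]])
        (auto simp: exp_inv_def eventually_at_filter)
    then show ?thesis using 3
      by (simp add: DERIV_def exp_inv_def[of _ 0])
  qed
qed

text \<open>The chain rule leads to the members \<open>j + 1\<close> and \<open>j + 2\<close> of the
  family and to a partial derivative of \<open>q\<close>. So the induction on \<open>k\<close> keeps
  \<open>j\<close> arbitrary, and \<open>q\<close> is taken smooth of every order.\<close>

lemma C_k_on_exp_inv:
  assumes "open W" and q: "\<And>k. C_k_on k W q"
  shows "C_k_on k W (\<lambda>x. exp_inv j (q x))"
proof (induction k arbitrary: j)
  case 0
  have "continuous_on UNIV (exp_inv j)"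
    using exp_inv_deriv by (meson DERIV_isCont continuous_at_imp_continuous_on)
  with q[of 0] show ?case
    by (auto intro: continuous_on_compose2)
next
  case (Suc k)
  show ?case
  proof (rule C_k_on_Suc_derivI[OF assms(1)])
    show "((\<lambda>x. exp_inv j (q x)) has_derivative
       (\<lambda>v. (exp_inv (j + 2) (q x) - real j * exp_inv (j + 1) (q x)) * frechet_derivative q (at x) v)) (at x)"
      if "x \<in> W" for x
      using has_derivative_compose[OF C_k_on_Suc_has_derivative[OF assms(1) q that]
          exp_inv_deriv[of j "q x", unfolded has_field_derivative_def]] by simp
    have "C_k_on k W (\<lambda>x. (exp_inv (j + 2) (q x) + (- real j) * exp_inv (j + 1) (q x)) *
        frechet_derivative q (at x) (axis i 1))" for i
      using q[of "Suc k"] by (intro C_k_on_mult C_k_on_add C_k_on_cmult Suc.IH assms(1)) auto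
    then show "C_k_on k W (\<lambda>x. (exp_inv (j + 2) (q x) - real j * exp_inv (j + 1) (q x)) *
        frechet_derivative q (at x) (axis i 1))" for i
      by simp
  qed
qed

lemma C_k_on_sum:
  assumes "open W" "\<And>i. i \<in> I \<Longrightarrow> C_k_on k W (f i)"
  shows "C_k_on k W (\<lambda>x. \<Sum>i\<in>I. f i x)"
  using assms(2)
  by (induction I rule: infinite_finite_induct) (auto intro: C_k_on_const C_k_on_add[OF assms(1)])

text \<open>The bump is exp (- 1 / (r^2 - |x - x0|^2)) inside a ball around x0 and 0 outside.
  \<open>K\<close> is the closed ball of radius \<open>r\<close>, chosen to lie in
  \<open>W\<close>.\<close>

lemma smooth_bump_exists:
  fixes W :: "(real^'n::finite) set"
  assumes "open W" "x0 \<in> W"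
  obtains \<rho> K where "\<rho> \<in> smooth_functions W" "\<rho> x0 \<noteq> 0" "compact K" "K \<subseteq> W"
    "\<And>x. x \<notin> K \<Longrightarrow> \<rho> x = 0"
proof -
  obtain r where r: "r > 0" "cball x0 r \<subseteq> W"
    using assms open_contains_cball by blast
  \<comment> \<open>This is r^2 - |x - x0|^2, spelled with sums and products only so that the
    closure rules for \<open>C_k_on\<close> apply directly.\<close>
  define q where "q = (\<lambda>x. r\<^sup>2 + (\<Sum>i\<in>UNIV. (- 1) * ((x $ i + - (x0 $ i)) * (x $ i + - (x0 $ i)))))"
  have q: "q x = r\<^sup>2 - (norm (x - x0))\<^sup>2" for x
    unfolding q_def power2_norm_eq_inner inner_vec_def by (simp add: sum_negf)
  have "C_k_on k W q" for k
    unfolding q_def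
    by (intro C_k_on_add C_k_on_sum C_k_on_cmult C_k_on_mult C_k_on_vec_nth C_k_on_const assms(1))
  then have C: "C_k_on k W (\<lambda>x. exp_inv 0 (q x))" for k
    by (rule C_k_on_exp_inv[OF assms(1)])
  have z: "exp_inv 0 (q x) = 0" if "x \<notin> cball x0 r" for x
  proof -
    have "r\<^sup>2 \<le> (norm (x - x0))\<^sup>2"
      using that r(1) by (intro power_mono) (auto simp: dist_norm norm_minus_commute)
    then show ?thesis by (simp add: exp_inv_def q)
  qed
  show thesis
  proof
    show "(\<lambda>x. exp_inv 0 (q x)) \<in> smooth_functions W"
      using C z r(2) unfolding smooth_functions_def by blast
    show "exp_inv 0 (q x0) \<noteq> 0" using r(1) by (simp add: exp_inv_def q)
  qed (use r z in auto)
qed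

section \<open>Smooth functions extended by zero, and their partial derivatives\<close>

lemma smooth_functionsD: "f \<in> smooth_functions W \<Longrightarrow> C_k_on k W f" "f \<in> smooth_functions W \<Longrightarrow> x \<notin> W \<Longrightarrow> f x = 0"
  by (auto simp: smooth_functions_def)

lemma smooth_functionsI: "(\<And>k. C_k_on k W f) \<Longrightarrow> (\<And>x. x \<notin> W \<Longrightarrow> f x = 0) \<Longrightarrow> f \<in> smooth_functions W"
  by (auto simp: smooth_functions_def)

lemma smooth_functions_restrictI:
  assumes "open W" "\<And>k. C_k_on k W f"
  shows "(\<lambda>x. if x \<in> W then f x else 0) \<in> smooth_functions W"
proof (rule smooth_functionsI)
  show "C_k_on k W (\<lambda>x. if x \<in> W then f x else 0)" for k
    using assms(2) by (subst C_k_on_cong[OF assms(1), of _ f]) auto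
qed simp

lemma smooth_functions_zero [simp]: "(\<lambda>x. 0) \<in> smooth_functions W"
  by (simp add: smooth_functions_def C_k_on_const)

lemma smooth_functions_add:
  "open W \<Longrightarrow> f \<in> smooth_functions W \<Longrightarrow> g \<in> smooth_functions W \<Longrightarrow> (\<lambda>x. f x + g x) \<in> smooth_functions W"
  by (simp add: smooth_functions_def C_k_on_add)

lemma smooth_functions_mult:
  "open W \<Longrightarrow> f \<in> smooth_functions W \<Longrightarrow> g \<in> smooth_functions W \<Longrightarrow> (\<lambda>x. f x * g x) \<in> smooth_functions W"
  by (simp add: smooth_functions_def C_k_on_mult)

lemma smooth_functions_cmult:
  "open W \<Longrightarrow> f \<in> smooth_functions W \<Longrightarrow> (\<lambda>x. a * f x) \<in> smooth_functions W"
  by (simp add: smooth_functions_def C_k_on_cmult)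

lemma smooth_functions_has_derivative:
  assumes "open W" "f \<in> smooth_functions W" "x \<in> W"
  shows "(f has_derivative frechet_derivative f (at x)) (at x)"
  by (rule C_k_on_Suc_has_derivative[OF assms(1) smooth_functionsD(1)[OF assms(2), of "Suc 0"] assms(3)])

lemma partial_on_eqI:
  assumes "x \<in> W" "(f has_derivative D) (at x)"
  shows "partial_on W i f x = D (axis i 1)"
  using assms frechet_derivative_at[OF assms(2)] by (simp add: partial_on_def)

lemma partial_on_outside: "x \<notin> W \<Longrightarrow> partial_on W i f x = 0"
  by (simp add: partial_on_def)

lemma partial_on_zero [simp]: "partial_on W i (\<lambda>x. 0) = (\<lambda>x. 0)"
  by (auto simp: partial_on_def frechet_derivative_const fun_eq_iff)

lemma partial_on_smooth:
  assumes "open W" "f \<in> smooth_functions W"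
  shows "partial_on W i f \<in> smooth_functions W"
  unfolding partial_on_def
  by (rule smooth_functions_restrictI[OF assms(1)]) (use smooth_functionsD(1)[OF assms(2), of "Suc _"] in simp)

lemma partial_on_add:
  assumes "open W" "f \<in> smooth_functions W" "g \<in> smooth_functions W"
  shows "partial_on W i (\<lambda>x. f x + g x) = (\<lambda>x. partial_on W i f x + partial_on W i g x)"
proof
  fix x
  note D = smooth_functions_has_derivative[OF assms(1)]
  show "partial_on W i (\<lambda>x. f x + g x) x = partial_on W i f x + partial_on W i g x"
  proof (cases "x \<in> W")
    case True
    show ?thesis
      using partial_on_eqI[OF True has_derivative_add[OF D[OF assms(2) True] D[OF assms(3) True]], of i] True
      by (simp add: partial_on_def)
  qed (simp add: partial_on_outside)
qed

lemma partial_on_mult: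
  assumes "open W" "f \<in> smooth_functions W" "g \<in> smooth_functions W"
  shows "partial_on W i (\<lambda>x. f x * g x) = (\<lambda>x. partial_on W i f x * g x + f x * partial_on W i g x)"
proof
  fix x
  note D = smooth_functions_has_derivative[OF assms(1)]
  show "partial_on W i (\<lambda>x. f x * g x) x = partial_on W i f x * g x + f x * partial_on W i g x"
  proof (cases "x \<in> W")
    case True
    show ?thesis
      using partial_on_eqI[OF True has_derivative_mult[OF D[OF assms(2) True] D[OF assms(3) True]], of i] True
      by (simp add: partial_on_def)
  qed (simp add: partial_on_outside)
qed

lemma partial_on_cmult:
  assumes "open W" "f \<in> smooth_functions W"
  shows "partial_on W i (\<lambda>x. a * f x) = (\<lambda>x. a * partial_on W i f x)"
proof
  fix x
  show "partial_on W i (\<lambda>x. a * f x) x = a * partial_on W i f x"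
  proof (cases "x \<in> W")
    case True
    show ?thesis
      using partial_on_eqI[OF True has_derivative_mult_right[OF smooth_functions_has_derivative[OF assms True]], of i a] True
      by (simp add: partial_on_def)
  qed (simp add: partial_on_outside)
qed

lemma partial_on_restrict:
  assumes "open W'" "W' \<subseteq> W"
  shows "partial_on W' i (\<lambda>x. if x \<in> W' then f x else 0) = (\<lambda>x. if x \<in> W' then partial_on W i f x else 0)"
proof
  fix x
  show "partial_on W' i (\<lambda>x. if x \<in> W' then f x else 0) x = (if x \<in> W' then partial_on W i f x else 0)"
    using assms(2) frechet_derivative_cong_open[OF assms(1), of x "\<lambda>x. if x \<in> W' then f x else 0" f]
    by (auto simp: partial_on_def)
qed

lemma partial_on_const_coord:
  fixes W :: "(real^'n) set"
  assumes "open W"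
  shows "partial_on W i (\<lambda>x. if x \<in> W then a else 0) = (\<lambda>x. 0)"
    and "partial_on W i (\<lambda>x. if x \<in> W then x $ j else 0) = (\<lambda>x. if x \<in> W \<and> i = j then 1 else 0)"
proof -
  have "frechet_derivative (\<lambda>x. x $ j) (at x) = (\<lambda>x. x $ j)" for x :: "real^'n"
    by (rule frechet_derivative_at[symmetric]) (rule bounded_linear_imp_has_derivative[OF bounded_linear_vec_nth])
  then show "partial_on W i (\<lambda>x. if x \<in> W then x $ j else 0) = (\<lambda>x. if x \<in> W \<and> i = j then 1 else 0)"
    by (subst partial_on_restrict[OF assms subset_refl]) (auto simp: partial_on_def axis_def fun_eq_iff)
  show "partial_on W i (\<lambda>x. if x \<in> W then a else 0) = (\<lambda>x. 0)"
    by (subst partial_on_restrict[OF assms subset_refl]) (auto simp: partial_on_def frechet_derivative_const fun_eq_iff)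
qed

section \<open>Superalgebras and sheaves\<close>

lemma koszul_simps [simp]: "koszul 0 q = 1" "koszul p 0 = 1" "koszul 1 1 = - 1"
  by (simp_all add: koszul_def)

lemma bit_cases: "p = 0 \<or> p = 1" for p :: bit
  by (cases p) auto

lemma superalgebraD:
  assumes "superalgebra A G"
  shows "ring A" and "module real_ring A"
    and "\<forall>c. \<forall>x\<in>carrier A. \<forall>y\<in>carrier A.
        (c \<odot>\<^bsub>A\<^esub> x) \<otimes>\<^bsub>A\<^esub> y = c \<odot>\<^bsub>A\<^esub> (x \<otimes>\<^bsub>A\<^esub> y) \<and>
        x \<otimes>\<^bsub>A\<^esub> (c \<odot>\<^bsub>A\<^esub> y) = c \<odot>\<^bsub>A\<^esub> (x \<otimes>\<^bsub>A\<^esub> y)"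
    and "\<forall>p. G p \<subseteq> carrier A \<and> \<zero>\<^bsub>A\<^esub> \<in> G p \<and>
        (\<forall>x\<in>G p. \<forall>y\<in>G p. x \<oplus>\<^bsub>A\<^esub> y \<in> G p) \<and> (\<forall>c. \<forall>x\<in>G p. c \<odot>\<^bsub>A\<^esub> x \<in> G p)"
    and "\<forall>x\<in>carrier A. \<exists>!(x0, x1). x0 \<in> G 0 \<and> x1 \<in> G 1 \<and> x = x0 \<oplus>\<^bsub>A\<^esub> x1"
    and "\<one>\<^bsub>A\<^esub> \<in> G 0"
    and "\<forall>p q. \<forall>x\<in>G p. \<forall>y\<in>G q. x \<otimes>\<^bsub>A\<^esub> y \<in> G (p + q) \<and>
        x \<otimes>\<^bsub>A\<^esub> y = koszul p q \<odot>\<^bsub>A\<^esub> (y \<otimes>\<^bsub>A\<^esub> x)"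
proof -
  note d = assms[unfolded superalgebra_def]
  note t3 = d[THEN conjunct2, THEN conjunct2]
  note t4 = t3[THEN conjunct2]
  note t5 = t4[THEN conjunct2]
  note t6 = t5[THEN conjunct2]
  note t7 = t6[THEN conjunct2]
  show "ring A" by (rule d[THEN conjunct1])
  show "module real_ring A" by (rule d[THEN conjunct2, THEN conjunct1])
  show "\<forall>c. \<forall>x\<in>carrier A. \<forall>y\<in>carrier A.
        (c \<odot>\<^bsub>A\<^esub> x) \<otimes>\<^bsub>A\<^esub> y = c \<odot>\<^bsub>A\<^esub> (x \<otimes>\<^bsub>A\<^esub> y) \<and>
        x \<otimes>\<^bsub>A\<^esub> (c \<odot>\<^bsub>A\<^esub> y) = c \<odot>\<^bsub>A\<^esub> (x \<otimes>\<^bsub>A\<^esub> y)" by (rule t3[THEN conjunct1])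
  show "\<forall>p. G p \<subseteq> carrier A \<and> \<zero>\<^bsub>A\<^esub> \<in> G p \<and>
        (\<forall>x\<in>G p. \<forall>y\<in>G p. x \<oplus>\<^bsub>A\<^esub> y \<in> G p) \<and> (\<forall>c. \<forall>x\<in>G p. c \<odot>\<^bsub>A\<^esub> x \<in> G p)"
    by (rule t4[THEN conjunct1])
  show "\<forall>x\<in>carrier A. \<exists>!(x0, x1). x0 \<in> G 0 \<and> x1 \<in> G 1 \<and> x = x0 \<oplus>\<^bsub>A\<^esub> x1"
    by (rule t5[THEN conjunct1])
  show "\<one>\<^bsub>A\<^esub> \<in> G 0" by (rule t6[THEN conjunct1])
  show "\<forall>p q. \<forall>x\<in>G p. \<forall>y\<in>G q. x \<otimes>\<^bsub>A\<^esub> y \<in> G (p + q) \<and>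
        x \<otimes>\<^bsub>A\<^esub> y = koszul p q \<odot>\<^bsub>A\<^esub> (y \<otimes>\<^bsub>A\<^esub> x)"
    by (rule t7)
qed

locale superalg =
  fixes A :: "(real, 'a) module" (structure) and G :: "bit \<Rightarrow> 'a set"
  assumes superalgebra: "superalgebra A G"
begin

sublocale ring A
  using superalgebra by (rule superalgebraD(1))

sublocale real_module: module real_ring A
  using superalgebra by (rule superalgebraD(2))

lemma smult_real_closed [simp]: "x \<in> carrier A \<Longrightarrow> a \<odot> x \<in> carrier A"
  using real_module.smult_closed by (simp add: real_ring_def)

lemma smult_real_one [simp]: "x \<in> carrier A \<Longrightarrow> 1 \<odot> x = x"
  using real_module.smult_one by (simp add: real_ring_def)

lemma smult_real_zero [simp]: "a \<odot> \<zero> = \<zero>"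
  using real_module.smult_r_null by (simp add: real_ring_def)

lemma smult_real_add_left: "x \<in> carrier A \<Longrightarrow> (a + b) \<odot> x = a \<odot> x \<oplus> b \<odot> x"
  using real_module.smult_l_distr by (simp add: real_ring_def)

lemma smult_real_assoc: "x \<in> carrier A \<Longrightarrow> a \<odot> (b \<odot> x) = (a * b) \<odot> x"
  using real_module.smult_assoc1 by (simp add: real_ring_def)

lemma smult_real_zero_left [simp]: "x \<in> carrier A \<Longrightarrow> 0 \<odot> x = \<zero>"
  using real_module.smult_l_null by (simp add: real_ring_def)

lemma smult_real_minus_one [simp]: "x \<in> carrier A \<Longrightarrow> (- 1) \<odot> x = \<ominus> x"
proof (rule minus_equality[symmetric])
  assume "x \<in> carrier A"
  then show "(- 1) \<odot> x \<oplus> x = \<zero>" "(- 1) \<odot> x \<in> carrier A"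
    using smult_real_add_left[of x "- 1" 1] by simp_all
qed

lemma smult_real_mult:
  "x \<in> carrier A \<Longrightarrow> y \<in> carrier A \<Longrightarrow> (a \<odot> x) \<otimes> y = a \<odot> (x \<otimes> y)"
  "x \<in> carrier A \<Longrightarrow> y \<in> carrier A \<Longrightarrow> x \<otimes> (a \<odot> y) = a \<odot> (x \<otimes> y)"
  by (rule superalgebraD(3)[OF superalgebra, rule_format, THEN conjunct1]
      superalgebraD(3)[OF superalgebra, rule_format, THEN conjunct2]; assumption)+

lemma graded_closed: "x \<in> G p \<Longrightarrow> x \<in> carrier A"
  using superalgebraD(4)[OF superalgebra] by blast

lemma zero_graded [simp]: "\<zero> \<in> G p"
  using superalgebraD(4)[OF superalgebra] by blast

lemma one_graded: "\<one> \<in> G 0"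
  by (rule superalgebraD(6)[OF superalgebra])

lemma mult_graded: "x \<in> G p \<Longrightarrow> y \<in> G q \<Longrightarrow> x \<otimes> y \<in> G (p + q)"
  by (rule superalgebraD(7)[OF superalgebra, rule_format, THEN conjunct1])

lemma graded_commute: "x \<in> G p \<Longrightarrow> y \<in> G q \<Longrightarrow> x \<otimes> y = koszul p q \<odot> (y \<otimes> x)"
  by (rule superalgebraD(7)[OF superalgebra, rule_format, THEN conjunct2])

text \<open>Stated relative to a parity \<open>p\<close>, with \<open>p + 1\<close> the opposite
  one, so that the part of interest comes first in both cases.\<close>

lemma decomposition:
  assumes "x \<in> carrier A"
  obtains x0 x1 where "x0 \<in> G p" "x1 \<in> G (p + 1)" "x = x0 \<oplus> x1"
proof -
  have "\<exists>!(x0, x1). x0 \<in> G 0 \<and> x1 \<in> G 1 \<and> x = x0 \<oplus> x1"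
    using superalgebraD(5)[OF superalgebra] assms by blast
  then obtain x0 x1 where "x0 \<in> G 0" "x1 \<in> G 1" "x = x0 \<oplus> x1" by auto
  moreover from this have "x = x1 \<oplus> x0"
    by (simp add: a_comm graded_closed)
  ultimately show thesis
    using that[of x0 x1] that[of x1 x0] bit_cases[of p] by auto
qed

lemma decomposition_unique:
  assumes "x0 \<in> G 0" "x1 \<in> G 1" "y0 \<in> G 0" "y1 \<in> G 1" "x0 \<oplus> x1 = y0 \<oplus> y1"
  shows "x0 = y0 \<and> x1 = y1"
proof -
  have "\<exists>!(z0, z1). z0 \<in> G 0 \<and> z1 \<in> G 1 \<and> x0 \<oplus> x1 = z0 \<oplus> z1"
    using superalgebraD(5)[OF superalgebra, rule_format, of "x0 \<oplus> x1"] graded_closed assms(1,2) by simp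
  then obtain z where z: "\<And>z'. (case z' of (z0, z1) \<Rightarrow> z0 \<in> G 0 \<and> z1 \<in> G 1 \<and> x0 \<oplus> x1 = z0 \<oplus> z1) \<Longrightarrow> z' = z"
    by (auto simp: Ex1_def)
  from z[of "(x0, x1)"] z[of "(y0, y1)"] show ?thesis using assms by auto
qed

text \<open>A homogeneous element is its own decomposition, with second part 0; uniqueness of the
  decomposition does the rest. This is the test for homogeneity used for sections and for
  pullbacks.\<close>

lemma other_part_zero:
  assumes "x0 \<in> G p" "x1 \<in> G (p + 1)" "x0 \<oplus> x1 \<in> G p"
  shows "x1 = \<zero>"
proof -
  note c = assms[THEN graded_closed]
  consider "p = 0" | "p = 1" using bit_cases by blast
  then show ?thesis
  proof cases
    case 1
    then show ?thesis
      using decomposition_unique[of x0 x1 "x0 \<oplus> x1" \<zero>] assms c by simp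
  next
    case 2
    then show ?thesis
      using decomposition_unique[of x1 x0 \<zero> "x0 \<oplus> x1"] assms c a_comm[of x1 x0] by simp
  qed
qed

text \<open>The commutation rule is available for homogeneous pairs only. Both parts of
  \<open>y\<close> commute with an even \<open>x\<close> without a sign.\<close>

lemma even_commute:
  assumes "x \<in> G 0" "y \<in> carrier A"
  shows "x \<otimes> y = y \<otimes> x"
proof -
  obtain y0 y1 where y: "y0 \<in> G 0" "y1 \<in> G (0 + 1)" "y = y0 \<oplus> y1"
    using decomposition[OF assms(2)] .
  note c = assms(1)[THEN graded_closed] y(1,2)[THEN graded_closed]
  show ?thesis
    using graded_commute[OF assms(1) y(1)] graded_commute[OF assms(1) y(2)] c
    by (simp add: y(3) r_distr l_distr)
qed

end

section \<open>Restriction maps and gluing over two open sets\<close>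

lemma superalgebra_homD:
  assumes "superalgebra_hom A G B H h"
  shows "x \<in> carrier A \<Longrightarrow> h x \<in> carrier B"
    and "x \<in> carrier A \<Longrightarrow> y \<in> carrier A \<Longrightarrow> h (x \<oplus>\<^bsub>A\<^esub> y) = h x \<oplus>\<^bsub>B\<^esub> h y"
    and "x \<in> carrier A \<Longrightarrow> y \<in> carrier A \<Longrightarrow> h (x \<otimes>\<^bsub>A\<^esub> y) = h x \<otimes>\<^bsub>B\<^esub> h y"
    and "h \<one>\<^bsub>A\<^esub> = \<one>\<^bsub>B\<^esub>"
    and "x \<in> carrier A \<Longrightarrow> h (a \<odot>\<^bsub>A\<^esub> x) = a \<odot>\<^bsub>B\<^esub> h x"
    and "x \<in> G p \<Longrightarrow> h x \<in> H p"
  using assms unfolding superalgebra_hom_def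
  by (auto simp: image_subset_iff dest: ring_hom_closed ring_hom_add ring_hom_mult ring_hom_one)

locale superspace_sheaf =
  fixes M :: "('p::topological_space, 's) superspace"
  assumes sheaf: "sheaf_of_superalgebras M"
begin

lemma superalg_sections: "open U \<Longrightarrow> superalg (sections M U) (graded M U)"
  using sheaf by (simp add: sheaf_of_superalgebras_def superalg_def)

lemma sections_closed:
  assumes "open U"
  shows "f \<in> graded M U p \<Longrightarrow> f \<in> carrier (sections M U)"
    and "f \<in> carrier (sections M U) \<Longrightarrow> h \<in> carrier (sections M U) \<Longrightarrow>
      f \<oplus>\<^bsub>sections M U\<^esub> h \<in> carrier (sections M U)"
    and "f \<in> carrier (sections M U) \<Longrightarrow> h \<in> carrier (sections M U) \<Longrightarrow>
      f \<otimes>\<^bsub>sections M U\<^esub> h \<in> carrier (sections M U)"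
    and "f \<in> carrier (sections M U) \<Longrightarrow> a \<odot>\<^bsub>sections M U\<^esub> f \<in> carrier (sections M U)"
    and "\<zero>\<^bsub>sections M U\<^esub> \<in> carrier (sections M U)"
proof -
  interpret U: superalg "sections M U" "graded M U" using assms by (rule superalg_sections)
  show "f \<in> graded M U p \<Longrightarrow> f \<in> carrier (sections M U)"
    and "f \<in> carrier (sections M U) \<Longrightarrow> h \<in> carrier (sections M U) \<Longrightarrow>
      f \<oplus>\<^bsub>sections M U\<^esub> h \<in> carrier (sections M U)"
    and "f \<in> carrier (sections M U) \<Longrightarrow> h \<in> carrier (sections M U) \<Longrightarrow>
      f \<otimes>\<^bsub>sections M U\<^esub> h \<in> carrier (sections M U)"
    and "f \<in> carrier (sections M U) \<Longrightarrow> a \<odot>\<^bsub>sections M U\<^esub> f \<in> carrier (sections M U)"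
    and "\<zero>\<^bsub>sections M U\<^esub> \<in> carrier (sections M U)"
    by (auto intro: U.graded_closed)
qed

lemma restr_hom:
  assumes "open U" "open V" "V \<subseteq> U"
  shows "superalgebra_hom (sections M U) (graded M U) (sections M V) (graded M V) (restr M U V)"
  using sheaf assms by (auto simp: sheaf_of_superalgebras_def)

lemmas restr_homD = superalgebra_homD[OF restr_hom]

lemma restr_zero:
  assumes "open U" "open V" "V \<subseteq> U"
  shows "restr M U V \<zero>\<^bsub>sections M U\<^esub> = \<zero>\<^bsub>sections M V\<^esub>"
proof -
  interpret U: superalg "sections M U" "graded M U" using assms by (simp add: superalg_sections)
  interpret V: superalg "sections M V" "graded M V" using assms by (simp add: superalg_sections)
  show ?thesis
    using restr_homD(5)[OF assms, of "\<zero>\<^bsub>sections M U\<^esub>" 0] restr_homD(1)[OF assms, of "\<zero>\<^bsub>sections M U\<^esub>"]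
    by simp
qed

lemma restr_id: "open U \<Longrightarrow> s \<in> carrier (sections M U) \<Longrightarrow> restr M U U s = s"
  by (rule sheaf[unfolded sheaf_of_superalgebras_def, THEN conjunct2, THEN conjunct2, THEN conjunct1,
        THEN spec, THEN mp, THEN bspec])

lemma restr_trans:
  "open U \<Longrightarrow> open V \<Longrightarrow> open W \<Longrightarrow> W \<subseteq> V \<Longrightarrow> V \<subseteq> U \<Longrightarrow> s \<in> carrier (sections M U) \<Longrightarrow>
    restr M V W (restr M U V s) = restr M U W s"
  by (rule sheaf[unfolded sheaf_of_superalgebras_def, THEN conjunct2, THEN conjunct2, THEN conjunct2,
        THEN conjunct1, THEN spec, THEN spec, THEN spec, THEN mp, THEN bspec]) simp_all

lemma glue:
  assumes "\<forall>V\<in>C. open V" "\<forall>V\<in>C. s V \<in> carrier (sections M V)"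
    and "\<forall>V\<in>C. \<forall>W\<in>C. restr M V (V \<inter> W) (s V) = restr M W (V \<inter> W) (s W)"
  shows "\<exists>!t. t \<in> carrier (sections M (\<Union>C)) \<and> (\<forall>V\<in>C. restr M (\<Union>C) V t = s V)"
  by (rule sheaf[unfolded sheaf_of_superalgebras_def, THEN conjunct2, THEN conjunct2, THEN conjunct2,
        THEN conjunct2, THEN spec, THEN mp, THEN spec, THEN mp, OF assms(1) conjI[OF assms(2,3)]])

text \<open>Both \<open>s\<close> and \<open>t\<close> glue the family of restrictions of
  \<open>s\<close> to \<open>V1\<close> and \<open>V2\<close>, and gluing is unique.\<close>

lemma glue2_unique:
  assumes o: "open V1" "open V2" and V: "V = V1 \<union> V2"
    and st: "s \<in> carrier (sections M V)" "t \<in> carrier (sections M V)"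
    and eq: "restr M V V1 s = restr M V V1 t" "restr M V V2 s = restr M V V2 t"
  shows "s = t"
proof -
  have U: "\<Union>{V1, V2} = V" using V by auto
  have oV: "open V" using o V by auto
  have "\<exists>!t. t \<in> carrier (sections M (\<Union>{V1, V2})) \<and>
      (\<forall>W\<in>{V1, V2}. restr M (\<Union>{V1, V2}) W t = restr M V W s)"
  proof (rule glue)
    show "\<forall>W\<in>{V1, V2}. restr M V W s \<in> carrier (sections M W)"
      using o oV V st(1) by (auto intro!: restr_homD(1))
    have "restr M W (W \<inter> W') (restr M V W s) = restr M V (W \<inter> W') s"
      if "W \<in> {V1, V2}" "W' \<in> {V1, V2}" for W W'
      using that o oV V st(1) by (intro restr_trans) auto
    then show "\<forall>W\<in>{V1, V2}. \<forall>W'\<in>{V1, V2}. restr M W (W \<inter> W') (restr M V W s) =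
        restr M W' (W \<inter> W') (restr M V W' s)"
      by (metis Int_commute)
  qed (use o in auto)
  then obtain u where u: "\<And>t. t \<in> carrier (sections M V) \<Longrightarrow>
      \<forall>W\<in>{V1, V2}. restr M V W t = restr M V W s \<Longrightarrow> t = u"
    unfolding U by (elim ex1E) blast
  have "s = u" by (rule u) (use st in auto)
  moreover have "t = u" by (rule u) (use st eq in auto)
  ultimately show ?thesis by simp
qed

lemma glue2_exists:
  assumes o: "open V1" "open V2"
    and ab: "a \<in> carrier (sections M V1)" "b \<in> carrier (sections M V2)"
    and eq: "restr M V1 (V1 \<inter> V2) a = restr M V2 (V1 \<inter> V2) b"
  obtains t where "t \<in> carrier (sections M (V1 \<union> V2))"
    "restr M (V1 \<union> V2) V1 t = a" "restr M (V1 \<union> V2) V2 t = b"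
\<comment> \<open>A family of sections over a cover is indexed by the open sets themselves. If the
  two sets coincide, it cannot assign \<open>a\<close> to one and \<open>b\<close> to the other; the
  overlap condition then forces \<open>a = b\<close>.\<close>
proof (cases "V1 = V2")
  case True
  then show thesis using that[of a] o ab eq by (simp add: restr_id)
next
  case False
  define s where "s = (\<lambda>W. if W = V1 then a else b)"
  have s: "s V1 = a" "s V2 = b" using False by (auto simp: s_def)
  have "\<exists>!t. t \<in> carrier (sections M (\<Union>{V1, V2})) \<and>
      (\<forall>W\<in>{V1, V2}. restr M (\<Union>{V1, V2}) W t = s W)"
    by (rule glue) (use o ab eq in \<open>simp_all add: s Int_commute\<close>)
  then obtain t where "t \<in> carrier (sections M (\<Union>{V1, V2}))"
      "\<forall>W\<in>{V1, V2}. restr M (\<Union>{V1, V2}) W t = s W" by (elim ex1E) blast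
  then show thesis using that[of t] by (simp add: s)
qed

text \<open>The component of the opposite parity vanishes on both pieces of the cover, hence on
  \<open>V\<close>. This is how sections obtained by gluing are seen to be homogeneous.\<close>

lemma graded_local:
  assumes o: "open V1" "open V2" and V: "V = V1 \<union> V2" and s: "s \<in> carrier (sections M V)"
    and gr: "restr M V V1 s \<in> graded M V1 p" "restr M V V2 s \<in> graded M V2 p"
  shows "s \<in> graded M V p"
proof -
  have oV: "open V" using o V by auto
  interpret V: superalg "sections M V" "graded M V" using oV by (simp add: superalg_sections)
  obtain s0 s1 where d: "s0 \<in> graded M V p" "s1 \<in> graded M V (p + 1)" "s = s0 \<oplus>\<^bsub>sections M V\<^esub> s1"
    using V.decomposition[OF s] .
  note c = d(1,2)[THEN V.graded_closed]
  have "restr M V W s1 = \<zero>\<^bsub>sections M W\<^esub>"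
    if W: "open W" "W \<subseteq> V" "restr M V W s \<in> graded M W p" for W
  proof -
    interpret W: superalg "sections M W" "graded M W" using W by (simp add: superalg_sections)
    note r = restr_homD[OF oV W(1,2)]
    show ?thesis
      using W.other_part_zero[OF r(6)[OF d(1)] r(6)[OF d(2)]] W(3) r(2)[OF c] d(3) by simp
  qed
  note r1 = this
  have "s1 = \<zero>\<^bsub>sections M V\<^esub>"
    by (rule glue2_unique[OF o V]) (use o gr V oV c r1 restr_zero[OF oV] V.zero_closed in auto)
  with d(1,3) c show ?thesis by simp
qed

subsection \<open>Vector fields\<close>

lemma vf_normalise_apply:
  "open V \<Longrightarrow> V \<subseteq> U \<Longrightarrow> f \<in> carrier (sections M V) \<Longrightarrow> vf_normalise M U X V f = X V f"
  by (simp add: vf_normalise_def)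

lemma vf_normalise_cong:
  "(\<And>V f. open V \<Longrightarrow> V \<subseteq> U \<Longrightarrow> f \<in> carrier (sections M V) \<Longrightarrow> X V f = Y V f) \<Longrightarrow>
    vf_normalise M U X = vf_normalise M U Y"
  by (auto simp: vf_normalise_def fun_eq_iff)

lemma vect_homD:
  assumes "X \<in> vect_hom M U p" "open V" "V \<subseteq> U"
  shows "f \<in> graded M V q \<Longrightarrow> X V f \<in> graded M V (p + q)"
    and "f \<in> carrier (sections M V) \<Longrightarrow> h \<in> carrier (sections M V) \<Longrightarrow>
      X V (f \<oplus>\<^bsub>sections M V\<^esub> h) = X V f \<oplus>\<^bsub>sections M V\<^esub> X V h"
    and "f \<in> carrier (sections M V) \<Longrightarrow>
      X V (a \<odot>\<^bsub>sections M V\<^esub> f) = a \<odot>\<^bsub>sections M V\<^esub> X V f"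
    and "f \<in> graded M V q \<Longrightarrow> h \<in> carrier (sections M V) \<Longrightarrow>
      X V (f \<otimes>\<^bsub>sections M V\<^esub> h) = (X V f \<otimes>\<^bsub>sections M V\<^esub> h) \<oplus>\<^bsub>sections M V\<^esub>
        (koszul p q \<odot>\<^bsub>sections M V\<^esub> (f \<otimes>\<^bsub>sections M V\<^esub> X V h))"
    and "open W \<Longrightarrow> W \<subseteq> V \<Longrightarrow> f \<in> carrier (sections M V) \<Longrightarrow>
      restr M V W (X V f) = X W (restr M V W f)"
proof -
  note X = assms(1)[unfolded vect_hom_def mem_Collect_eq]
  note V = X[THEN conjunct2, THEN conjunct1, THEN spec, THEN mp, OF conjI[OF assms(2,3)]]
  note W = X[THEN conjunct2, THEN conjunct2, THEN spec, THEN spec, THEN mp, THEN bspec]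
  show "f \<in> graded M V q \<Longrightarrow> X V f \<in> graded M V (p + q)"
    by (rule V[THEN conjunct1, THEN spec, THEN bspec])
  show "f \<in> carrier (sections M V) \<Longrightarrow> h \<in> carrier (sections M V) \<Longrightarrow>
      X V (f \<oplus>\<^bsub>sections M V\<^esub> h) = X V f \<oplus>\<^bsub>sections M V\<^esub> X V h"
    by (rule V[THEN conjunct2, THEN conjunct1, THEN bspec, THEN bspec])
  show "f \<in> carrier (sections M V) \<Longrightarrow>
      X V (a \<odot>\<^bsub>sections M V\<^esub> f) = a \<odot>\<^bsub>sections M V\<^esub> X V f"
    by (rule V[THEN conjunct2, THEN conjunct2, THEN conjunct1, THEN spec, THEN bspec])
  show "f \<in> graded M V q \<Longrightarrow> h \<in> carrier (sections M V) \<Longrightarrow>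
      X V (f \<otimes>\<^bsub>sections M V\<^esub> h) = (X V f \<otimes>\<^bsub>sections M V\<^esub> h) \<oplus>\<^bsub>sections M V\<^esub>
        (koszul p q \<odot>\<^bsub>sections M V\<^esub> (f \<otimes>\<^bsub>sections M V\<^esub> X V h))"
    by (rule V[THEN conjunct2, THEN conjunct2, THEN conjunct2, THEN spec, THEN bspec, THEN bspec])
  show "open W \<Longrightarrow> W \<subseteq> V \<Longrightarrow> f \<in> carrier (sections M V) \<Longrightarrow>
      restr M V W (X V f) = X W (restr M V W f)"
    using assms(2,3) by (intro W) simp_all
qed

text \<open>The definition of \<open>vect_hom\<close> places values in the algebra for homogeneous
  arguments only; additivity extends this to sums of an even and an odd part.\<close>

lemma vect_hom_closed:
  assumes "X \<in> vect_hom M U p" "open V" "V \<subseteq> U" "f \<in> carrier (sections M V)"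
  shows "X V f \<in> carrier (sections M V)"
proof -
  interpret V: superalg "sections M V" "graded M V" using assms by (simp add: superalg_sections)
  obtain f0 f1 where f: "f0 \<in> graded M V 0" "f1 \<in> graded M V (0 + 1)" "f = f0 \<oplus>\<^bsub>sections M V\<^esub> f1"
    using V.decomposition[OF assms(4)] .
  note X = f(1,2)[THEN vect_homD(1)[OF assms(1-3)], THEN V.graded_closed]
  show ?thesis
    using vect_homD(2)[OF assms(1-3) f(1,2)[THEN V.graded_closed]] X f(3) by simp
qed

lemma vect_hom_normalised: "X \<in> vect_hom M U p \<Longrightarrow> vf_normalise M U X = X"
  unfolding vect_hom_def by simp

text \<open>Every vector field constructed below comes from this rule: the derivation laws are
  checked for the raw family on open subsets of \<open>U\<close>, and the normalisation outside is
  dealt with once.\<close>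

lemma vf_normaliseI:
  assumes U: "open U"
    and gr: "\<And>V f q. open V \<Longrightarrow> V \<subseteq> U \<Longrightarrow> f \<in> graded M V q \<Longrightarrow> X V f \<in> graded M V (p + q)"
    and add: "\<And>V f h. open V \<Longrightarrow> V \<subseteq> U \<Longrightarrow> f \<in> carrier (sections M V) \<Longrightarrow> h \<in> carrier (sections M V) \<Longrightarrow>
      X V (f \<oplus>\<^bsub>sections M V\<^esub> h) = X V f \<oplus>\<^bsub>sections M V\<^esub> X V h"
    and scale: "\<And>V f a. open V \<Longrightarrow> V \<subseteq> U \<Longrightarrow> f \<in> carrier (sections M V) \<Longrightarrow>
      X V (a \<odot>\<^bsub>sections M V\<^esub> f) = a \<odot>\<^bsub>sections M V\<^esub> X V f"
    and leibniz: "\<And>V f h q. open V \<Longrightarrow> V \<subseteq> U \<Longrightarrow> f \<in> graded M V q \<Longrightarrow> h \<in> carrier (sections M V) \<Longrightarrow>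
      X V (f \<otimes>\<^bsub>sections M V\<^esub> h) = (X V f \<otimes>\<^bsub>sections M V\<^esub> h) \<oplus>\<^bsub>sections M V\<^esub>
        (koszul p q \<odot>\<^bsub>sections M V\<^esub> (f \<otimes>\<^bsub>sections M V\<^esub> X V h))"
    and restr: "\<And>V W f. open V \<Longrightarrow> open W \<Longrightarrow> W \<subseteq> V \<Longrightarrow> V \<subseteq> U \<Longrightarrow> f \<in> carrier (sections M V) \<Longrightarrow>
      restr M V W (X V f) = X W (restr M V W f)"
  shows "vf_normalise M U X \<in> vect_hom M U p"
  unfolding vect_hom_def
proof (intro CollectI conjI)
  show "vf_normalise M U X = vf_normalise M U (vf_normalise M U X)"
    by (rule vf_normalise_cong) (simp add: vf_normalise_apply)
next
  show "\<forall>V W. open V \<and> open W \<and> W \<subseteq> V \<and> V \<subseteq> U \<longrightarrow>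
      (\<forall>f\<in>carrier (sections M V).
        restr M V W (vf_normalise M U X V f) = vf_normalise M U X W (restr M V W f))"
  proof (intro allI impI ballI)
    fix V W f
    assume *: "open V \<and> open W \<and> W \<subseteq> V \<and> V \<subseteq> U" and f: "f \<in> carrier (sections M V)"
    then have "restr M V W f \<in> carrier (sections M W)" "W \<subseteq> U" by (auto intro: restr_homD(1))
    with * f restr show "restr M V W (vf_normalise M U X V f) = vf_normalise M U X W (restr M V W f)"
      by (simp add: vf_normalise_apply)
  qed
qed (use gr add scale leibniz in \<open>simp add: vf_normalise_apply sections_closed\<close>)

lemma vf_normalise_vect_hom:
  assumes "X \<in> vect_hom M U p" "open V" "V \<subseteq> U"
  shows "vf_normalise M V X \<in> vect_hom M V p"
proof (rule vf_normaliseI[OF assms(2)])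
  note sub = subset_trans[OF _ assms(3)]
  note D = vect_homD[OF assms(1) _ sub]
  show "X W f \<in> graded M W (p + q)" if "open W" "W \<subseteq> V" "f \<in> graded M W q" for W f q
    using D(1)[OF that] .
  show "X W (f \<oplus>\<^bsub>sections M W\<^esub> h) = X W f \<oplus>\<^bsub>sections M W\<^esub> X W h"
    if "open W" "W \<subseteq> V" "f \<in> carrier (sections M W)" "h \<in> carrier (sections M W)" for W f h
    using D(2)[OF that] .
  show "X W (a \<odot>\<^bsub>sections M W\<^esub> f) = a \<odot>\<^bsub>sections M W\<^esub> X W f"
    if "open W" "W \<subseteq> V" "f \<in> carrier (sections M W)" for W f a
    using D(3)[OF that] .
  show "X W (f \<otimes>\<^bsub>sections M W\<^esub> h) = (X W f \<otimes>\<^bsub>sections M W\<^esub> h) \<oplus>\<^bsub>sections M W\<^esub>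
      (koszul p q \<odot>\<^bsub>sections M W\<^esub> (f \<otimes>\<^bsub>sections M W\<^esub> X W h))"
    if "open W" "W \<subseteq> V" "f \<in> graded M W q" "h \<in> carrier (sections M W)" for W f h q
    using D(4)[OF that] .
  show "restr M W W' (X W f) = X W' (restr M W W' f)"
    if "open W" "open W'" "W' \<subseteq> W" "W \<subseteq> V" "f \<in> carrier (sections M W)" for W W' f
    using D(5)[OF that(1,4,2,3,5)] .
qed

lemma vf_zero_vect_hom:
  assumes "open U"
  shows "vf_zero M U \<in> vect_hom M U p"
  unfolding vf_zero_def
proof (rule vf_normaliseI[OF assms])
  note S = superalg_sections
  show "\<zero>\<^bsub>sections M V\<^esub> \<in> graded M V (p + q)" if "open V" for V q
    using superalg.zero_graded[OF S[OF that]] .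
  show "\<zero>\<^bsub>sections M V\<^esub> = \<zero>\<^bsub>sections M V\<^esub> \<oplus>\<^bsub>sections M V\<^esub> \<zero>\<^bsub>sections M V\<^esub>" if "open V" for V
  proof -
    interpret V: superalg "sections M V" "graded M V" using S[OF that] .
    show ?thesis by simp
  qed
  show "\<zero>\<^bsub>sections M V\<^esub> = a \<odot>\<^bsub>sections M V\<^esub> \<zero>\<^bsub>sections M V\<^esub>" if "open V" for V a
    using superalg.smult_real_zero[OF S[OF that]] by simp
  show "\<zero>\<^bsub>sections M V\<^esub> = \<zero>\<^bsub>sections M V\<^esub> \<otimes>\<^bsub>sections M V\<^esub> h \<oplus>\<^bsub>sections M V\<^esub>
      koszul p q \<odot>\<^bsub>sections M V\<^esub> (f \<otimes>\<^bsub>sections M V\<^esub> \<zero>\<^bsub>sections M V\<^esub>)"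
    if "open V" "V \<subseteq> U" "f \<in> graded M V q" "h \<in> carrier (sections M V)" for V f h q
  proof -
    interpret V: superalg "sections M V" "graded M V" using S[OF that(1)] .
    show ?thesis using that(4) V.graded_closed[OF that(3)] by simp
  qed
qed (rule restr_zero)

text \<open>Elements of \<open>vect\<close> are sums of an even and an odd field. The zero field has
  both parities and supplies the missing summand.\<close>

lemma vect_hom_vect:
  assumes "open U" "X \<in> vect_hom M U p"
  shows "X \<in> vect M U"
proof -
  have "vf_add M U X (vf_zero M U) = vf_normalise M U X \<and> vf_add M U (vf_zero M U) X = vf_normalise M U X"
    unfolding vf_add_def
  proof (intro conjI vf_normalise_cong)
    fix V f assume V: "open V" "V \<subseteq> U" "f \<in> carrier (sections M V)"
    interpret V: superalg "sections M V" "graded M V" using superalg_sections[OF V(1)] .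
    show "X V f \<oplus>\<^bsub>sections M V\<^esub> vf_zero M U V f = X V f"
      "vf_zero M U V f \<oplus>\<^bsub>sections M V\<^esub> X V f = X V f"
      using vect_hom_closed[OF assms(2) V] V by (simp_all add: vf_zero_def vf_normalise_apply)
  qed
  then have *: "X = vf_add M U X (vf_zero M U)" "X = vf_add M U (vf_zero M U) X"
    using vect_hom_normalised[OF assms(2)] by simp_all
  have "p = 0 \<or> p = 1" by (rule bit_cases)
  then show ?thesis
    unfolding vect_def using * assms(2) vf_zero_vect_hom[OF assms(1)] by blast
qed

lemma vf_smult_vect_hom:
  assumes X: "X \<in> vect_hom M U p" and U: "open U" and h: "h \<in> graded M U 0"
  shows "vf_smult M U h X \<in> vect_hom M U p"
  unfolding vf_smult_def
proof (rule vf_normaliseI[OF U])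
  fix V assume V: "open V" "V \<subseteq> U"
  interpret V: superalg "sections M V" "graded M V" using superalg_sections[OF V(1)] .
  note D = vect_homD[OF X V] and cl = vect_hom_closed[OF X V]
  define e where "e = restr M U V h"
  have e0: "e \<in> graded M V 0" using restr_homD(6)[OF U V h] by (simp add: e_def)
  then have e: "e \<in> carrier (sections M V)" by (rule V.graded_closed)
  show "restr M U V h \<otimes>\<^bsub>sections M V\<^esub> X V f \<in> graded M V (p + q)" if "f \<in> graded M V q" for f q
    using V.mult_graded[OF e0 D(1)[OF that]] by (simp only: e_def add_0)
  show "restr M U V h \<otimes>\<^bsub>sections M V\<^esub> X V (f \<oplus>\<^bsub>sections M V\<^esub> k) =
      restr M U V h \<otimes>\<^bsub>sections M V\<^esub> X V f \<oplus>\<^bsub>sections M V\<^esub> restr M U V h \<otimes>\<^bsub>sections M V\<^esub> X V k"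
    if "f \<in> carrier (sections M V)" "k \<in> carrier (sections M V)" for f k
    unfolding e_def[symmetric] D(2)[OF that] by (rule V.r_distr) (use that e cl in auto)
  show "restr M U V h \<otimes>\<^bsub>sections M V\<^esub> X V (a \<odot>\<^bsub>sections M V\<^esub> f) =
      a \<odot>\<^bsub>sections M V\<^esub> (restr M U V h \<otimes>\<^bsub>sections M V\<^esub> X V f)"
    if "f \<in> carrier (sections M V)" for a f
    unfolding e_def[symmetric] D(3)[OF that] by (rule V.smult_real_mult) (use that e cl in auto)
  show "restr M U V h \<otimes>\<^bsub>sections M V\<^esub> X V (f \<otimes>\<^bsub>sections M V\<^esub> k) =
      restr M U V h \<otimes>\<^bsub>sections M V\<^esub> X V f \<otimes>\<^bsub>sections M V\<^esub> k \<oplus>\<^bsub>sections M V\<^esub>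
      koszul p q \<odot>\<^bsub>sections M V\<^esub> (f \<otimes>\<^bsub>sections M V\<^esub> (restr M U V h \<otimes>\<^bsub>sections M V\<^esub> X V k))"
    if fk: "f \<in> graded M V q" "k \<in> carrier (sections M V)" for f k q
  proof -
    have f: "f \<in> carrier (sections M V)" using V.graded_closed[OF fk(1)] .
    note c = e f fk(2) cl[OF f] cl[OF fk(2)]
    \<comment> \<open>The even coefficient moves past \<open>f\<close> without a sign, so the
      product keeps the Leibniz sign of \<open>X\<close>.\<close>
    have "e \<otimes>\<^bsub>sections M V\<^esub> (f \<otimes>\<^bsub>sections M V\<^esub> X V k) = f \<otimes>\<^bsub>sections M V\<^esub> (e \<otimes>\<^bsub>sections M V\<^esub> X V k)"
      using V.even_commute[OF e0 f] c by (metis V.m_assoc)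
    then show ?thesis
      unfolding e_def[symmetric] D(4)[OF fk]
      using c by (simp add: V.r_distr V.m_assoc V.smult_real_mult)
  qed
next
  fix V W f assume V: "open V" "open W" "W \<subseteq> V" "V \<subseteq> U" "f \<in> carrier (sections M V)"
  have h': "h \<in> carrier (sections M U)" using sections_closed(1)[OF U h] .
  show "restr M V W (restr M U V h \<otimes>\<^bsub>sections M V\<^esub> X V f) =
      restr M U W h \<otimes>\<^bsub>sections M W\<^esub> X W (restr M V W f)"
    using restr_homD(3)[OF V(1-3) restr_homD(1)[OF U V(1,4) h'] vect_hom_closed[OF X V(1,4,5)]]
      restr_trans[OF U V(1,2,3,4) h'] vect_homD(5)[OF X V(1,4,2,3,5)] by simp
qed

text \<open>Since \<open>K\<close> is closed and contained in \<open>U\<close>, every open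
  \<open>V\<close> is covered by the open sets \<open>V \<inter> U\<close> and \<open>V - K\<close>.
  The value on \<open>f\<close> is glued from the value of \<open>X\<close> on the first and 0 on
  the second; these agree on the overlap, which lies in \<open>U - K\<close>.\<close>

lemma vect_hom_extend_by_zero:
  assumes X: "X \<in> vect_hom M U p" and U: "open U" and K: "closed K" "K \<subseteq> U"
    and vanish: "\<And>V f. open V \<Longrightarrow> V \<subseteq> U - K \<Longrightarrow> f \<in> carrier (sections M V) \<Longrightarrow> X V f = \<zero>\<^bsub>sections M V\<^esub>"
  obtains Y where "Y \<in> vect_hom M UNIV p" "vf_normalise M U Y = X"
proof -
  \<comment> \<open>A relation rather than a function: it characterises the glued section by its two
    restrictions, and the value is then picked with \<open>THE\<close>.\<close>
  define ext where "ext V f y \<longleftrightarrow> y \<in> carrier (sections M V) \<and>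
      restr M V (V \<inter> U) y = X (V \<inter> U) (restr M V (V \<inter> U) f) \<and>
      restr M V (V - K) y = \<zero>\<^bsub>sections M (V - K)\<^esub>" for V f y
  define Y where "Y V f = (THE y. ext V f y)" for V f
  have o: "open (V \<inter> U)" "open (V - K)" "V = (V \<inter> U) \<union> (V - K)" if "open V" for V
    using that U K by auto
  have uniq: "y = z" if "open V" "ext V f y" "ext V f z" for V f y z
    by (rule glue2_unique[OF o[OF that(1)]]) (use that in \<open>auto simp: ext_def\<close>)
  have "\<exists>y. ext V f y" if V: "open V" and f: "f \<in> carrier (sections M V)" for V f
  proof -
    let ?f = "restr M V (V \<inter> U) f" and ?W = "(V \<inter> U) \<inter> (V - K)"
    have W: "open ?W" "?W \<subseteq> V \<inter> U" "?W \<subseteq> V - K" "?W \<subseteq> U - K" using o[OF V] by auto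
    have f': "?f \<in> carrier (sections M (V \<inter> U))" using f V o by (intro restr_homD(1)) auto
    have "restr M (V \<inter> U) ?W (X (V \<inter> U) ?f) = \<zero>\<^bsub>sections M ?W\<^esub>"
      unfolding vect_homD(5)[OF X o(1)[OF V] Int_lower2 W(1,2) f']
      using vanish[OF W(1,4)] restr_homD(1)[OF o(1)[OF V] W(1,2) f'] by simp
    then obtain y where "y \<in> carrier (sections M (V \<inter> U \<union> (V - K)))"
        "restr M (V \<inter> U \<union> (V - K)) (V \<inter> U) y = X (V \<inter> U) ?f"
        "restr M (V \<inter> U \<union> (V - K)) (V - K) y = \<zero>\<^bsub>sections M (V - K)\<^esub>"
      using glue2_exists[OF o(1,2)[OF V] vect_hom_closed[OF X o(1)[OF V] Int_lower2 f']
          sections_closed(5)[OF o(2)[OF V]]] restr_zero[OF o(2)[OF V] W(1,3)] by metis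
    then show ?thesis using o(3)[OF V] unfolding ext_def by metis
  qed
  then have ext: "ext V f (Y V f)" if "open V" "f \<in> carrier (sections M V)" for V f
    unfolding Y_def using that by (metis theI uniq)
  \<comment> \<open>The algebraic laws of \<open>Y\<close> and its compatibility with restriction
    all reduce to this: the right-hand side only has to restrict correctly to the two
    pieces.\<close>
  have eqI: "Y V f = y" if "open V" "f \<in> carrier (sections M V)" "ext V f y" for V f y
    using uniq[OF that(1) ext[OF that(1,2)] that(3)] .
  have "vf_normalise M UNIV Y \<in> vect_hom M UNIV p"
  proof (rule vf_normaliseI[OF open_UNIV])
    fix V :: "'p set" assume V: "open V"
    note oV = o[OF V]
    have sub: "V \<inter> U \<subseteq> V" "V - K \<subseteq> V" "V \<inter> U \<subseteq> U" by auto
    interpret V: superalg "sections M V" "graded M V" using superalg_sections[OF V] .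
    interpret V1: superalg "sections M (V \<inter> U)" "graded M (V \<inter> U)" using superalg_sections[OF oV(1)] .
    interpret V2: superalg "sections M (V - K)" "graded M (V - K)" using superalg_sections[OF oV(2)] .
    note r1 = restr_homD[OF V oV(1) sub(1)] and r2 = restr_homD[OF V oV(2) sub(2)]
    note D = vect_homD[OF X oV(1) sub(3)] and cl = vect_hom_closed[OF X oV(1) sub(3)]
    note e = ext[OF V, unfolded ext_def, THEN conjunct1]
      ext[OF V, unfolded ext_def, THEN conjunct2, THEN conjunct1]
      ext[OF V, unfolded ext_def, THEN conjunct2, THEN conjunct2]
    show "Y V f \<in> graded M V (p + q)" if "f \<in> graded M V q" for f q
    proof (rule graded_local[OF oV])
      note f = V.graded_closed[OF that]
      show "Y V f \<in> carrier (sections M V)" using e(1)[OF f] .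
      show "restr M V (V \<inter> U) (Y V f) \<in> graded M (V \<inter> U) (p + q)"
        unfolding e(2)[OF f] by (rule D(1)[OF r1(6)[OF that]])
      show "restr M V (V - K) (Y V f) \<in> graded M (V - K) (p + q)"
        unfolding e(3)[OF f] by (rule V2.zero_graded)
    qed
    show "Y V (f \<oplus>\<^bsub>sections M V\<^esub> h) = Y V f \<oplus>\<^bsub>sections M V\<^esub> Y V h"
      if fh: "f \<in> carrier (sections M V)" "h \<in> carrier (sections M V)" for f h
    proof (rule eqI[OF V])
      show "ext V (f \<oplus>\<^bsub>sections M V\<^esub> h) (Y V f \<oplus>\<^bsub>sections M V\<^esub> Y V h)"
        unfolding ext_def using fh e[OF fh(1)] e[OF fh(2)] r1(1)[OF fh(1)] r1(1)[OF fh(2)]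
        by (simp add: r1(2) r2(2) D(2))
    qed (use fh in simp)
    show "Y V (a \<odot>\<^bsub>sections M V\<^esub> f) = a \<odot>\<^bsub>sections M V\<^esub> Y V f"
      if f: "f \<in> carrier (sections M V)" for a f
    proof (rule eqI[OF V])
      show "ext V (a \<odot>\<^bsub>sections M V\<^esub> f) (a \<odot>\<^bsub>sections M V\<^esub> Y V f)"
        unfolding ext_def using f e[OF f] r1(1)[OF f] by (simp add: r1(5) r2(5) D(3))
    qed (use f in simp)
    show "Y V (f \<otimes>\<^bsub>sections M V\<^esub> h) = (Y V f \<otimes>\<^bsub>sections M V\<^esub> h) \<oplus>\<^bsub>sections M V\<^esub>
        (koszul p q \<odot>\<^bsub>sections M V\<^esub> (f \<otimes>\<^bsub>sections M V\<^esub> Y V h))"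
      if fq: "f \<in> graded M V q" and h: "h \<in> carrier (sections M V)" for f h q
    proof (rule eqI[OF V])
      note f = V.graded_closed[OF fq]
      show "ext V (f \<otimes>\<^bsub>sections M V\<^esub> h) ((Y V f \<otimes>\<^bsub>sections M V\<^esub> h) \<oplus>\<^bsub>sections M V\<^esub>
        (koszul p q \<odot>\<^bsub>sections M V\<^esub> (f \<otimes>\<^bsub>sections M V\<^esub> Y V h)))"
        unfolding ext_def
        using f h e[OF f] e[OF h] r1(1)[OF f] r1(1)[OF h] r2(1)[OF f] r2(1)[OF h]
        by (simp add: r1(2,3,5) r2(2,3,5) D(4)[OF r1(6)[OF fq] r1(1)[OF h]])
    qed (use V.graded_closed[OF fq] h in simp)
  next
    fix V W :: "'p set" and f
    assume V: "open V" "open W" "W \<subseteq> V" and f: "f \<in> carrier (sections M V)"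
    note e = ext[OF V(1) f, unfolded ext_def]
    have sub: "V \<inter> U \<subseteq> V" "V \<inter> U \<subseteq> U" "V - K \<subseteq> V" "W \<inter> U \<subseteq> W" "W - K \<subseteq> W"
      "W \<inter> U \<subseteq> V \<inter> U" "W - K \<subseteq> V - K" using V by auto
    note oV = o[OF V(1)] and oW = o[OF V(2)]
    note fU = restr_homD(1)[OF V(1) oV(1) sub(1) f]
    show "restr M V W (Y V f) = Y W (restr M V W f)"
    proof (rule eqI[OF V(2), symmetric])
      have "restr M W (W \<inter> U) (restr M V W (Y V f)) = restr M (V \<inter> U) (W \<inter> U) (restr M V (V \<inter> U) (Y V f))"
        using e[THEN conjunct1] restr_trans[OF V(1,2) oW(1) sub(4) V(3)] restr_trans[OF V(1) oV(1) oW(1) sub(6,1)] by simp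
      also have "\<dots> = X (W \<inter> U) (restr M (V \<inter> U) (W \<inter> U) (restr M V (V \<inter> U) f))"
        using e vect_homD(5)[OF X oV(1) sub(2) oW(1) sub(6) fU] by simp
      also have "\<dots> = X (W \<inter> U) (restr M W (W \<inter> U) (restr M V W f))"
        using f restr_trans[OF V(1,2) oW(1) sub(4) V(3)] restr_trans[OF V(1) oV(1) oW(1) sub(6,1)] by simp
      finally have 1: "restr M W (W \<inter> U) (restr M V W (Y V f)) =
          X (W \<inter> U) (restr M W (W \<inter> U) (restr M V W f))" .
      have "restr M W (W - K) (restr M V W (Y V f)) = restr M (V - K) (W - K) (restr M V (V - K) (Y V f))"
        using e[THEN conjunct1] restr_trans[OF V(1,2) oW(2) sub(5) V(3)] restr_trans[OF V(1) oV(2) oW(2) sub(7,3)] by simp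
      also have "\<dots> = \<zero>\<^bsub>sections M (W - K)\<^esub>"
        using e restr_zero[OF oV(2) oW(2) sub(7)] by simp
      finally show "ext W (restr M V W f) (restr M V W (Y V f))"
        unfolding ext_def using 1 restr_homD(1)[OF V] e by simp
    qed (rule restr_homD(1)[OF V f])
  qed
  moreover have "vf_normalise M U (vf_normalise M UNIV Y) = vf_normalise M U X"
  proof (rule vf_normalise_cong)
    fix V f assume V: "open V" "V \<subseteq> U" "f \<in> carrier (sections M V)"
    \<comment> \<open>For \<open>V\<close> inside \<open>U\<close> the first piece of the cover is
      all of \<open>V\<close>, so the gluing condition itself says that the extension agrees with
      \<open>X\<close>.\<close>
    then have "V \<inter> U = V" by auto
    with ext[OF V(1,3)] restr_id[OF V(1)] show "vf_normalise M UNIV Y V f = X V f"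
      using V by (metis ext_def subset_UNIV vf_normalise_apply)
  qed
  ultimately show thesis
    using that vect_hom_normalised[OF X] by simp
qed

end

section \<open>The local model and charts\<close>

lemma model_simps [simp]:
  "carrier (model W) = smooth_functions W \<times> smooth_functions W"
  "(f0, f1) \<otimes>\<^bsub>model W\<^esub> (g0, g1) = (\<lambda>x. f0 x * g0 x, \<lambda>x. f1 x * g0 x + f0 x * g1 x)"
  "(f0, f1) \<oplus>\<^bsub>model W\<^esub> (g0, g1) = (\<lambda>x. f0 x + g0 x, \<lambda>x. f1 x + g1 x)"
  "a \<odot>\<^bsub>model W\<^esub> (f0, f1) = (\<lambda>x. a * f0 x, \<lambda>x. a * f1 x)"
  "\<one>\<^bsub>model W\<^esub> = (\<lambda>x. if x \<in> W then 1 else 0, \<lambda>x. 0)"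
  "\<zero>\<^bsub>model W\<^esub> = (\<lambda>x. 0, \<lambda>x. 0)"
  by (simp_all add: model_def)

lemma model_closed:
  assumes "open W" "f \<in> carrier (model W)" "g \<in> carrier (model W)"
  shows "f \<oplus>\<^bsub>model W\<^esub> g \<in> carrier (model W)" "f \<otimes>\<^bsub>model W\<^esub> g \<in> carrier (model W)"
    "a \<odot>\<^bsub>model W\<^esub> f \<in> carrier (model W)"
  using assms by (cases f; cases g; auto intro: smooth_functions_add smooth_functions_mult smooth_functions_cmult)+

lemma model_graded_closed: "f \<in> model_graded W p \<Longrightarrow> f \<in> carrier (model W)"
  by (auto simp: model_graded_def split: if_splits)

lemma model_deriv_closed:
  "open W \<Longrightarrow> f \<in> carrier (model W) \<Longrightarrow> model_deriv W A f \<in> carrier (model W)"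
  by (cases f; cases A) (auto simp: model_deriv_def partial_on_smooth)

lemma model_deriv_graded:
  assumes "open W" "f \<in> model_graded W q"
  shows "model_deriv W A f \<in> model_graded W (idx_parity A + q)"
  using assms by (cases f; cases A; cases q)
    (auto simp: model_deriv_def model_graded_def idx_parity_def partial_on_smooth)

lemma model_deriv_add:
  assumes "open W" "f \<in> carrier (model W)" "g \<in> carrier (model W)"
  shows "model_deriv W A (f \<oplus>\<^bsub>model W\<^esub> g) = model_deriv W A f \<oplus>\<^bsub>model W\<^esub> model_deriv W A g"
  using assms by (cases f; cases g; cases A) (auto simp: model_deriv_def partial_on_add)

lemma model_deriv_smult:
  assumes "open W" "f \<in> carrier (model W)"
  shows "model_deriv W A (a \<odot>\<^bsub>model W\<^esub> f) = a \<odot>\<^bsub>model W\<^esub> model_deriv W A f"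
  using assms by (cases f; cases A) (auto simp: model_deriv_def partial_on_cmult)

text \<open>The sign matters only for \<open>A = None\<close> and odd \<open>f\<close>. For f =
  \<tau> f1 and g = g0 + \<tau> g1 both sides are f1 g0: on the right the two terms \<tau> f1 g1
  cancel.\<close>

lemma model_deriv_mult:
  assumes "open W" "f \<in> model_graded W q" "g \<in> carrier (model W)"
  shows "model_deriv W A (f \<otimes>\<^bsub>model W\<^esub> g) = (model_deriv W A f \<otimes>\<^bsub>model W\<^esub> g) \<oplus>\<^bsub>model W\<^esub>
    (koszul (idx_parity A) q \<odot>\<^bsub>model W\<^esub> (f \<otimes>\<^bsub>model W\<^esub> model_deriv W A g))"
  using assms bit_cases[of q] by (cases f; cases g; cases A)
    (auto simp: model_deriv_def model_graded_def idx_parity_def partial_on_mult)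

lemma model_deriv_restr:
  assumes "open W'" "W' \<subseteq> W"
  shows "model_deriv W' A (model_restr W' f) = model_restr W' (model_deriv W A f)"
  using assms by (cases f; cases A) (auto simp: model_deriv_def model_restr_def partial_on_restrict)

lemma model_restr_closed:
  assumes "open W'" "W' \<subseteq> W" "f \<in> carrier (model W)"
  shows "model_restr W' f \<in> carrier (model W')"
  using assms by (cases f)
    (auto simp: model_restr_def intro!: smooth_functions_restrictI intro: C_k_on_subset[OF smooth_functionsD(1)])

lemma model_coord_graded: "open W \<Longrightarrow> model_coord W A \<in> model_graded W (idx_parity A)"
  by (cases A) (auto simp: model_coord_def model_graded_def idx_parity_def
    intro!: smooth_functions_restrictI C_k_on_const C_k_on_vec_nth)

lemma model_deriv_coord:
  "open W \<Longrightarrow> model_deriv W A (model_coord W B) = (if A = B then \<one>\<^bsub>model W\<^esub> else \<zero>\<^bsub>model W\<^esub>)"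
  by (cases A; cases B) (auto simp: model_deriv_def model_coord_def partial_on_const_coord fun_eq_iff)

section \<open>Transport between a chart and the local model\<close>

locale superspace_chart = superspace_sheaf M
  for M :: "('p::t2_space, 's) superspace" +
  fixes c :: "('p, 's, 'n::finite) chart"
  assumes chart: "is_chart M c"
begin

abbreviation U where "U \<equiv> chart_dom c"
abbreviation R where "R \<equiv> sections M (chart_dom c)"
abbreviation "img V \<equiv> chart_map c ` V"
abbreviation "pb V \<equiv> pullback c (chart_map c ` V)"

lemma open_dom: "open U" and open_range: "open (chart_range c)"
  by (rule chart[unfolded is_chart_def, THEN conjunct1],
      rule chart[unfolded is_chart_def, THEN conjunct2, THEN conjunct1])

lemma chart_homeomorphism:
  obtains \<psi> where "homeomorphism U (chart_range c) (chart_map c) \<psi>"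
  using chart[unfolded is_chart_def, THEN conjunct2, THEN conjunct2, THEN conjunct1] by blast

text \<open>Charts index pullbacks by open subsets of the range, vector fields use open subsets of
  the space. As \<open>V\<close> is the preimage of its image, the chart axioms can be applied with
  \<open>img V\<close> throughout.\<close>

lemma img_props:
  assumes "open V" "V \<subseteq> U"
  shows "open (img V)" "img V \<subseteq> chart_range c" "chart_preimage c (img V) = V"
proof -
  obtain \<psi> where h: "homeomorphism U (chart_range c) (chart_map c) \<psi>" by (rule chart_homeomorphism)
  show "open (img V)"
    using homeomorphism_imp_open_map[OF h, of V] assms open_dom open_range by (simp add: openin_open_eq)
  show "img V \<subseteq> chart_range c" using assms by (auto simp: chart_range_def)
  have "inj_on (chart_map c) U" using h by (metis homeomorphism_def inj_on_inverseI)
  then show "chart_preimage c (img V) = V"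
    using assms by (auto simp: chart_preimage_def dest: inj_onD)
qed

lemma pb_props:
  assumes "open V" "V \<subseteq> U"
  shows pb_bij: "bij_betw (pb V) (carrier (model (img V))) (carrier (sections M V))"
    and pb_hom: "superalgebra_hom (model (img V)) (model_graded (img V)) (sections M V) (graded M V) (pb V)"
  using chart[unfolded is_chart_def, THEN conjunct2, THEN conjunct2, THEN conjunct2, THEN conjunct1,
      THEN spec, of "img V"] img_props[OF assms]
  by simp_all

lemmas pb_homD = superalgebra_homD[OF pb_hom]

lemma pb_restr:
  assumes "open V" "open V'" "V' \<subseteq> V" "V \<subseteq> U" "f \<in> carrier (model (img V))"
  shows "restr M V V' (pb V f) = pb V' (model_restr (img V') f)"
proof -
  have "V' \<subseteq> U" using assms by auto
  then show ?thesis
    using chart[unfolded is_chart_def, THEN conjunct2, THEN conjunct2, THEN conjunct2, THEN conjunct2,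
      THEN spec, THEN spec, of "img V" "img V'"] img_props[OF assms(1,4)] img_props[OF assms(2)] assms(3,5)
    by (auto simp: image_mono)
qed

text \<open>The zero is written as 0 times itself and scalars are pulled out. This avoids the usual
  argument for ring homomorphisms, since the model is nowhere shown to be a ring.\<close>

lemma pb_zero:
  assumes "open V" "V \<subseteq> U"
  shows "pb V \<zero>\<^bsub>model (img V)\<^esub> = \<zero>\<^bsub>sections M V\<^esub>"
proof -
  interpret V: superalg "sections M V" "graded M V" using superalg_sections[OF assms(1)] .
  have z: "\<zero>\<^bsub>model (img V)\<^esub> \<in> carrier (model (img V))" by simp
  have "pb V (0 \<odot>\<^bsub>model (img V)\<^esub> \<zero>\<^bsub>model (img V)\<^esub>) = 0 \<odot>\<^bsub>sections M V\<^esub> pb V \<zero>\<^bsub>model (img V)\<^esub>"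
    by (rule pb_homD(5)[OF assms z])
  also have "\<dots> = \<zero>\<^bsub>sections M V\<^esub>" using pb_homD(1)[OF assms z] by simp
  finally show ?thesis by simp
qed

lemma pb_cases:
  assumes "open V" "V \<subseteq> U" "f \<in> carrier (sections M V)"
  obtains \<phi> where "\<phi> \<in> carrier (model (img V))" "f = pb V \<phi>"
  using assms pb_bij[OF assms(1,2)] unfolding bij_betw_def by blast

text \<open>A chart is only assumed to map homogeneous functions to homogeneous ones. For the
  converse, a preimage is split into its two parts; the pullback of the part of wrong parity
  vanishes, so that part may be dropped.\<close>

lemma pb_graded_cases:
  assumes V: "open V" "V \<subseteq> U" and f: "f \<in> graded M V q"
  obtains \<phi> where "\<phi> \<in> model_graded (img V) q" "f = pb V \<phi>"
proof -
  interpret V: superalg "sections M V" "graded M V" using superalg_sections[OF V(1)] .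
  obtain \<phi> where "\<phi> \<in> carrier (model (img V))" "f = pb V \<phi>"
    using pb_cases[OF V V.graded_closed[OF f]] .
  then obtain f0 f1 where \<phi>: "f0 \<in> smooth_functions (img V)" "f1 \<in> smooth_functions (img V)" "f = pb V (f0, f1)"
    by (cases \<phi>) auto
  define a0 where "a0 = pb V (f0, \<lambda>x. 0)"
  define a1 where "a1 = pb V (\<lambda>x. 0, f1)"
  have m: "(f0, \<lambda>x. 0) \<in> model_graded (img V) 0" "(\<lambda>x. 0, f1) \<in> model_graded (img V) 1"
    using \<phi> by (auto simp: model_graded_def)
  have a: "a0 \<in> graded M V 0" "a1 \<in> graded M V 1"
    unfolding a0_def a1_def by (rule pb_homD(6)[OF V m(1)], rule pb_homD(6)[OF V m(2)])
  note ac = a[THEN V.graded_closed]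
  have "(f0, f1) = (f0, \<lambda>x. 0) \<oplus>\<^bsub>model (img V)\<^esub> (\<lambda>x. 0, f1)" by simp
  then have s: "f = a0 \<oplus>\<^bsub>sections M V\<^esub> a1"
    unfolding \<phi>(3) a0_def a1_def using pb_homD(2)[OF V m[THEN model_graded_closed]] by metis
  then have s': "f = a1 \<oplus>\<^bsub>sections M V\<^esub> a0" using ac V.a_comm by simp
  show thesis
  proof (cases "q = 0")
    case True
    then have "a1 = \<zero>\<^bsub>sections M V\<^esub>" using V.other_part_zero[of a0 0 a1] a f s by simp
    then have "f = a0" using s ac by simp
    then show thesis using that m(1) True by (simp add: a0_def)
  next
    case False
    then have q: "q = 1" using bit_cases by blast
    then have "a0 = \<zero>\<^bsub>sections M V\<^esub>" using V.other_part_zero[of a1 1 a0] a f s' by simp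
    then have "f = a1" using s ac by simp
    then show thesis using that m(2) q by (simp add: a1_def)
  qed
qed

lemma coord_vf_apply:
  assumes "open V" "V \<subseteq> U" "\<phi> \<in> carrier (model (img V))"
  shows "coord_vf M c A V (pb V \<phi>) = pb V (model_deriv (img V) A \<phi>)"
proof -
  have "inv_into (carrier (model (img V))) (pb V) (pb V \<phi>) = \<phi>"
    using pb_bij[OF assms(1,2)] assms(3) by (meson bij_betw_def inv_into_f_f)
  then show ?thesis
    using vf_normalise_apply[OF assms(1,2) pb_homD(1)[OF assms]] by (simp add: coord_vf_def Let_def)
qed

text \<open>Each law is that of \<open>model_deriv\<close>, carried over by the bijections
  \<open>pb V\<close>: arguments are written as pullbacks and all operations are pushed
  inside.\<close>

lemma coord_vf_vect_hom: "coord_vf M c A \<in> vect_hom M U (idx_parity A)"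
proof -
  have "vf_normalise M U (coord_vf M c A) \<in> vect_hom M U (idx_parity A)"
  proof (rule vf_normaliseI[OF open_dom])
    fix V assume V: "open V" "V \<subseteq> U"
    let ?X = "coord_vf M c A V"
    note oW = img_props(1)[OF V]
    interpret V: superalg "sections M V" "graded M V" using superalg_sections[OF V(1)] .
    note h = pb_homD[OF V] and ap = coord_vf_apply[OF V]
    show "?X f \<in> graded M V (idx_parity A + q)" if f: "f \<in> graded M V q" for f q
    proof -
      obtain \<phi> where \<phi>: "\<phi> \<in> model_graded (img V) q" "f = pb V \<phi>" using pb_graded_cases[OF V f] .
      show ?thesis unfolding \<phi>(2) ap[OF model_graded_closed[OF \<phi>(1)]]
        by (rule h(6)[OF model_deriv_graded[OF oW \<phi>(1)]])
    qed
    show "?X (f \<oplus>\<^bsub>sections M V\<^esub> k) = ?X f \<oplus>\<^bsub>sections M V\<^esub> ?X k"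
      if fk: "f \<in> carrier (sections M V)" "k \<in> carrier (sections M V)" for f k
    proof -
      obtain \<phi> where \<phi>: "\<phi> \<in> carrier (model (img V))" "f = pb V \<phi>" using pb_cases[OF V fk(1)] .
      obtain \<kappa> where \<kappa>: "\<kappa> \<in> carrier (model (img V))" "k = pb V \<kappa>" using pb_cases[OF V fk(2)] .
      note d = model_deriv_closed[OF oW \<phi>(1), of A] model_deriv_closed[OF oW \<kappa>(1), of A]
      show ?thesis unfolding \<phi>(2) \<kappa>(2) h(2)[OF \<phi>(1) \<kappa>(1), symmetric] ap[OF \<phi>(1)] ap[OF \<kappa>(1)]
          ap[OF model_closed(1)[OF oW \<phi>(1) \<kappa>(1)]] model_deriv_add[OF oW \<phi>(1) \<kappa>(1)] by (rule h(2)[OF d])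
    qed
    show "?X (a \<odot>\<^bsub>sections M V\<^esub> f) = a \<odot>\<^bsub>sections M V\<^esub> ?X f"
      if f: "f \<in> carrier (sections M V)" for a f
    proof -
      obtain \<phi> where \<phi>: "\<phi> \<in> carrier (model (img V))" "f = pb V \<phi>" using pb_cases[OF V f] .
      show ?thesis unfolding \<phi>(2) h(5)[OF \<phi>(1), symmetric] ap[OF \<phi>(1)]
          ap[OF model_closed(3)[OF oW \<phi>(1) \<phi>(1)]] model_deriv_smult[OF oW \<phi>(1)]
        by (rule h(5)[OF model_deriv_closed[OF oW \<phi>(1)]])
    qed
    show "?X (f \<otimes>\<^bsub>sections M V\<^esub> k) = ?X f \<otimes>\<^bsub>sections M V\<^esub> k \<oplus>\<^bsub>sections M V\<^esub>
        koszul (idx_parity A) q \<odot>\<^bsub>sections M V\<^esub> (f \<otimes>\<^bsub>sections M V\<^esub> ?X k)"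
      if fk: "f \<in> graded M V q" "k \<in> carrier (sections M V)" for f k q
    proof -
      obtain \<phi> where \<phi>: "\<phi> \<in> model_graded (img V) q" "f = pb V \<phi>" using pb_graded_cases[OF V fk(1)] .
      obtain \<kappa> where \<kappa>: "\<kappa> \<in> carrier (model (img V))" "k = pb V \<kappa>" using pb_cases[OF V fk(2)] .
      note \<phi>c = model_graded_closed[OF \<phi>(1)]
      note d = model_deriv_closed[OF oW \<phi>c, of A] model_deriv_closed[OF oW \<kappa>(1), of A]
      note m = model_closed[OF oW]
      show ?thesis
        unfolding \<phi>(2) \<kappa>(2) h(3)[OF \<phi>c \<kappa>(1), symmetric] ap[OF \<phi>c] ap[OF \<kappa>(1)]
          ap[OF m(2)[OF \<phi>c \<kappa>(1)]] model_deriv_mult[OF oW \<phi>(1) \<kappa>(1)]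
          h(3)[OF d(1) \<kappa>(1), symmetric] h(3)[OF \<phi>c d(2), symmetric]
          h(5)[OF m(2)[OF \<phi>c d(2)], symmetric]
        by (rule h(2)[OF m(2)[OF d(1) \<kappa>(1)] m(3)[OF m(2)[OF \<phi>c d(2)] m(2)[OF \<phi>c d(2)]]])
    qed
  next
    fix V W f assume V: "open V" "open W" "W \<subseteq> V" "V \<subseteq> U" "f \<in> carrier (sections M V)"
    obtain \<phi> where \<phi>: "\<phi> \<in> carrier (model (img V))" "f = pb V \<phi>" using pb_cases[OF V(1,4,5)] .
    have W: "W \<subseteq> U" "img W \<subseteq> img V" using V by auto
    note oW = img_props(1)[OF V(2) W(1)] and oV = img_props(1)[OF V(1,4)]
    show "restr M V W (coord_vf M c A V f) = coord_vf M c A W (restr M V W f)"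
      unfolding \<phi>(2) coord_vf_apply[OF V(1,4) \<phi>(1)] pb_restr[OF V(1-4) \<phi>(1)]
        pb_restr[OF V(1-4) model_deriv_closed[OF oV \<phi>(1)]]
        coord_vf_apply[OF V(2) W(1) model_restr_closed[OF oW W(2) \<phi>(1)]]
        model_deriv_restr[OF oW W(2)] by (rule refl)
  qed
  moreover have "vf_normalise M U (coord_vf M c A) = coord_vf M c A"
    unfolding coord_vf_def by (rule vf_normalise_cong) (simp add: vf_normalise_apply)
  ultimately show ?thesis by simp
qed

lemma coord_graded: "coord c A \<in> graded M U (idx_parity A)"
  using pb_homD(6)[OF open_dom subset_refl model_coord_graded, of A] open_range
  by (simp add: coord_def chart_range_def)

lemma coord_vf_coord: "coord_vf M c A U (coord c B) = (if A = B then \<one>\<^bsub>R\<^esub> else \<zero>\<^bsub>R\<^esub>)"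
proof -
  have "coord_vf M c A U (pb U (model_coord (img U) B)) = pb U (model_deriv (img U) A (model_coord (img U) B))"
    by (rule coord_vf_apply[OF open_dom subset_refl model_graded_closed[OF model_coord_graded]])
      (use open_range in \<open>simp add: chart_range_def\<close>)
  then show ?thesis
    using open_range pb_homD(4)[OF open_dom subset_refl] pb_zero[OF open_dom subset_refl]
    by (simp add: coord_def chart_range_def model_deriv_coord del: model_simps)
qed

text \<open>The inverse \<psi> of the chart map carries \<open>K\<close> to a compact set, which is
  closed in the whole Hausdorff space and not just in the chart domain. Off this set \<rho>
  vanishes, so the field there is 0 and extends.\<close>

lemma extend_coord_vf:
  assumes \<rho>: "\<rho> \<in> smooth_functions (chart_range c)"
    and K: "compact K" "K \<subseteq> chart_range c" "\<And>x. x \<notin> K \<Longrightarrow> \<rho> x = 0"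
  obtains Y where "Y \<in> vect_hom M UNIV (idx_parity A)"
    "vf_normalise M U Y = vf_smult M U (pb U (\<rho>, \<lambda>x. 0)) (coord_vf M c A)"
proof -
  obtain \<psi> where h: "homeomorphism U (chart_range c) (chart_map c) \<psi>" by (rule chart_homeomorphism)
  let ?K = "\<psi> ` K"
  have "compact ?K"
    using h K(1,2) by (meson compact_continuous_image continuous_on_subset homeomorphism_def)
  then have K': "closed ?K" "?K \<subseteq> U"
    using h K(2) by (simp add: compact_imp_closed) (use h K(2) in \<open>unfold homeomorphism_def, blast\<close>)
  have \<rho>m: "(\<rho>, \<lambda>x. 0) \<in> model_graded (img U) 0"
    using \<rho> by (simp add: model_graded_def chart_range_def)
  note \<rho>g = pb_homD(6)[OF open_dom subset_refl \<rho>m]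
  show thesis
  proof (rule vect_hom_extend_by_zero[OF vf_smult_vect_hom[OF coord_vf_vect_hom open_dom \<rho>g] open_dom K'])
    fix V f assume V: "open V" "V \<subseteq> U - ?K" "f \<in> carrier (sections M V)"
    then have VU: "V \<subseteq> U" by auto
    interpret V: superalg "sections M V" "graded M V" using superalg_sections[OF V(1)] .
    have "\<rho> x = 0" if x: "x \<in> img V" for x
    proof (rule K(3))
      obtain v where "v \<in> V" "x = chart_map c v" using x by blast
      then show "x \<notin> K" using V(2) VU h by (force simp: homeomorphism_def)
    qed
    then have "model_restr (img V) (\<rho>, \<lambda>x. 0) = \<zero>\<^bsub>model (img V)\<^esub>"
      by (auto simp: model_restr_def)
    then have "restr M U V (pb U (\<rho>, \<lambda>x. 0)) = \<zero>\<^bsub>sections M V\<^esub>"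
      using pb_restr[OF open_dom V(1) VU subset_refl model_graded_closed[OF \<rho>m]] pb_zero[OF V(1) VU] by simp
    then show "vf_smult M U (pb U (\<rho>, \<lambda>x. 0)) (coord_vf M c A) V f = \<zero>\<^bsub>sections M V\<^esub>"
      using vect_hom_closed[OF coord_vf_vect_hom V(1) VU V(3)] vf_normalise_apply[OF V(1) VU V(3)]
      by (simp add: vf_smult_def)
  qed (rule that)
qed

text \<open>If \<open>S\<close> has the coefficients (s0, s1), its product with a bump has the
  coefficients (\<rho> s0, \<rho> s1). A bump that is nonzero at \<open>x\<close> therefore forces
  both to vanish at \<open>x\<close>.\<close>

lemma zero_by_bumps:
  assumes S: "S \<in> carrier R"
    and zero: "\<And>\<rho> K. \<rho> \<in> smooth_functions (chart_range c) \<Longrightarrow> compact K \<Longrightarrow> K \<subseteq> chart_range c \<Longrightarrow>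
      (\<And>x. x \<notin> K \<Longrightarrow> \<rho> x = 0) \<Longrightarrow> pb U (\<rho>, \<lambda>x. 0) \<otimes>\<^bsub>R\<^esub> S = \<zero>\<^bsub>R\<^esub>"
  shows "S = \<zero>\<^bsub>R\<^esub>"
proof -
  note h = pb_homD[OF open_dom subset_refl]
  have iU: "img U = chart_range c" by (simp add: chart_range_def)
  obtain s where "s \<in> carrier (model (img U))" "S = pb U s"
    using pb_cases[OF open_dom subset_refl S] .
  then obtain s0 s1 where s: "s0 \<in> smooth_functions (chart_range c)" "s1 \<in> smooth_functions (chart_range c)"
      "S = pb U (s0, s1)"
    using iU by (cases s) auto
  have "s0 x = 0 \<and> s1 x = 0" for x
  proof (cases "x \<in> chart_range c")
    case True
    obtain \<rho> K where \<rho>: "\<rho> \<in> smooth_functions (chart_range c)" "\<rho> x \<noteq> 0" "compact K" "K \<subseteq> chart_range c"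
        "\<And>x. x \<notin> K \<Longrightarrow> \<rho> x = 0"
      using smooth_bump_exists[OF open_range True] by metis
    have m: "(\<rho>, \<lambda>x. 0) \<in> carrier (model (img U))" "(s0, s1) \<in> carrier (model (img U))"
      using \<rho>(1) s iU by simp_all
    have "pb U ((\<rho>, \<lambda>x. 0) \<otimes>\<^bsub>model (img U)\<^esub> (s0, s1)) = pb U \<zero>\<^bsub>model (img U)\<^esub>"
      unfolding h(3)[OF m] pb_zero[OF open_dom subset_refl] s(3)[symmetric]
      using zero[OF \<rho>(1,3-5)] .
    moreover have "inj_on (pb U) (carrier (model (img U)))"
      using pb_bij[OF open_dom subset_refl] by (simp add: bij_betw_def)
    moreover have "(\<rho>, \<lambda>x. 0) \<otimes>\<^bsub>model (img U)\<^esub> (s0, s1) \<in> carrier (model (img U))"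
      using model_closed(2)[OF _ m] open_range iU by simp
    moreover have "\<zero>\<^bsub>model (img U)\<^esub> \<in> carrier (model (img U))" by simp
    ultimately have "(\<rho>, \<lambda>x. 0) \<otimes>\<^bsub>model (img U)\<^esub> (s0, s1) = \<zero>\<^bsub>model (img U)\<^esub>"
      by (meson inj_onD)
    then show ?thesis using \<rho>(2) by (auto simp: fun_eq_iff)
  qed (use s smooth_functionsD(2) in blast)
  then have "s0 = (\<lambda>x. 0)" "s1 = (\<lambda>x. 0)" by auto
  then show ?thesis using s(3) pb_zero[OF open_dom subset_refl] by simp
qed

end

section \<open>The components of the metric\<close>

context superspace_chart
begin

sublocale R: superalg R "graded M U"
  by (rule superalg_sections[OF open_dom])

text \<open>The field f \<partial>_B has the coefficient \<open>f\<close> at \<open>B\<close> and 0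
  elsewhere, which collapses the inner sum. As \<open>f\<close> is even, it can be moved to the
  front of every term and out of the sum: the pairing is linear in \<open>f\<close>.\<close>

lemma tensor_form_coord_vf:
  assumes h: "metric_components M c h" and tf: "tensor_form M g c h"
    and X: "X \<in> vect_hom M U p" and f: "f \<in> graded M U 0"
  shows "g U X (vf_smult M U f (coord_vf M c B)) =
    f \<otimes>\<^bsub>R\<^esub> (\<Oplus>\<^bsub>R\<^esub>A\<in>UNIV. koszul (idx_parity B) (idx_parity A) \<odot>\<^bsub>R\<^esub> (X U (coord c A) \<otimes>\<^bsub>R\<^esub> h B A))"
proof -
  let ?Y = "vf_smult M U f (coord_vf M c B)" and ?k = "\<lambda>A :: 'n option. koszul (idx_parity B) (idx_parity A)"
  have hc: "h A A' \<in> carrier R" for A A'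
    using h R.graded_closed unfolding metric_components_def by blast
  have cc: "coord c A \<in> carrier R" for A using R.graded_closed[OF coord_graded] .
  have Xc: "X U (coord c A) \<in> carrier R" for A using vect_hom_closed[OF X open_dom subset_refl cc] .
  have fc: "f \<in> carrier R" using R.graded_closed[OF f] .
  have Yc: "?Y U (coord c B') = (if B = B' then f else \<zero>\<^bsub>R\<^esub>)" for B'
    using fc by (simp add: vf_smult_def vf_normalise_apply[OF open_dom subset_refl cc]
        coord_vf_coord restr_id[OF open_dom])
  have Y: "?Y \<in> vect_hom M U (idx_parity B)"
    by (rule vf_smult_vect_hom[OF coord_vf_vect_hom open_dom f])
  have inner: "(\<Oplus>\<^bsub>R\<^esub>B'\<in>UNIV. ?k A \<odot>\<^bsub>R\<^esub> (X U (coord c A) \<otimes>\<^bsub>R\<^esub> ?Y U (coord c B') \<otimes>\<^bsub>R\<^esub> h B' A)) =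
      f \<otimes>\<^bsub>R\<^esub> (?k A \<odot>\<^bsub>R\<^esub> (X U (coord c A) \<otimes>\<^bsub>R\<^esub> h B A))" for A
  proof -
    have "(\<Oplus>\<^bsub>R\<^esub>B'\<in>UNIV. ?k A \<odot>\<^bsub>R\<^esub> (X U (coord c A) \<otimes>\<^bsub>R\<^esub> ?Y U (coord c B') \<otimes>\<^bsub>R\<^esub> h B' A)) =
        (\<Oplus>\<^bsub>R\<^esub>B'\<in>UNIV. if B = B' then ?k A \<odot>\<^bsub>R\<^esub> (X U (coord c A) \<otimes>\<^bsub>R\<^esub> f \<otimes>\<^bsub>R\<^esub> h B' A) else \<zero>\<^bsub>R\<^esub>)"
      using hc Xc fc by (intro R.finsum_cong'[OF refl]) (auto simp: Yc)
    also have "\<dots> = ?k A \<odot>\<^bsub>R\<^esub> (X U (coord c A) \<otimes>\<^bsub>R\<^esub> f \<otimes>\<^bsub>R\<^esub> h B A)"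
      using hc Xc fc by (intro R.finsum_singleton) auto
    also have "\<dots> = f \<otimes>\<^bsub>R\<^esub> (?k A \<odot>\<^bsub>R\<^esub> (X U (coord c A) \<otimes>\<^bsub>R\<^esub> h B A))"
      using hc Xc fc R.even_commute[OF f Xc[of A]] by (simp add: R.smult_real_mult R.m_assoc[symmetric])
    finally show ?thesis .
  qed
  have "g U X ?Y = (\<Oplus>\<^bsub>R\<^esub>A\<in>UNIV. \<Oplus>\<^bsub>R\<^esub>B'\<in>UNIV.
      ?k A \<odot>\<^bsub>R\<^esub> (X U (coord c A) \<otimes>\<^bsub>R\<^esub> ?Y U (coord c B') \<otimes>\<^bsub>R\<^esub> h B' A))"
    using tf[unfolded tensor_form_def Let_def, THEN spec, THEN bspec, OF vect_hom_vect[OF open_dom X], THEN bspec, OF Y] .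
  also have "\<dots> = (\<Oplus>\<^bsub>R\<^esub>A\<in>UNIV. f \<otimes>\<^bsub>R\<^esub> (?k A \<odot>\<^bsub>R\<^esub> (X U (coord c A) \<otimes>\<^bsub>R\<^esub> h B A)))"
    unfolding inner by (rule refl)
  also have "\<dots> = f \<otimes>\<^bsub>R\<^esub> (\<Oplus>\<^bsub>R\<^esub>A\<in>UNIV. ?k A \<odot>\<^bsub>R\<^esub> (X U (coord c A) \<otimes>\<^bsub>R\<^esub> h B A))"
    using hc Xc fc by (intro R.finsum_rdistr[symmetric]) auto
  finally show ?thesis .
qed

lemma vf_smult_one:
  assumes "X \<in> vect_hom M V p" "open V"
  shows "vf_smult M V \<one>\<^bsub>sections M V\<^esub> X = X"
proof -
  have "vf_smult M V \<one>\<^bsub>sections M V\<^esub> X = vf_normalise M V X"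
    unfolding vf_smult_def
  proof (rule vf_normalise_cong)
    fix W f assume W: "open W" "W \<subseteq> V" "f \<in> carrier (sections M W)"
    interpret W: superalg "sections M W" "graded M W" using superalg_sections[OF W(1)] .
    show "restr M V W \<one>\<^bsub>sections M V\<^esub> \<otimes>\<^bsub>sections M W\<^esub> X W f = X W f"
      using restr_homD(4)[OF assms(2) W(1,2)] vect_hom_closed[OF assms(1) W] by simp
  qed
  then show ?thesis using vect_hom_normalised[OF assms(1)] by simp
qed

text \<open>Pairing \<partial>_A with 1 \<partial>_B leaves the single term \<open>h B A\<close>
  with its Koszul sign, and graded symmetry makes this \<open>h A B\<close>. So the coefficients
  whose existence \<open>metric\<close> asserts are the components, and the rest can be argued about
  \<open>h\<close>.\<close>

lemma component_eq:
  assumes h: "metric_components M c h" and tf: "tensor_form M g c h"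
  shows "component M g c = h"
proof (intro ext)
  fix A B :: "'n option"
  have hc: "h A A' \<in> carrier R" for A A'
    using h R.graded_closed unfolding metric_components_def by blast
  let ?k = "\<lambda>A :: 'n option. koszul (idx_parity B) (idx_parity A)"
  have "component M g c A B = g U (coord_vf M c A) (vf_smult M U \<one>\<^bsub>R\<^esub> (coord_vf M c B))"
    by (simp add: component_def vf_smult_one[OF coord_vf_vect_hom open_dom])
  also have "\<dots> = \<one>\<^bsub>R\<^esub> \<otimes>\<^bsub>R\<^esub> (\<Oplus>\<^bsub>R\<^esub>A'\<in>UNIV. ?k A' \<odot>\<^bsub>R\<^esub> (coord_vf M c A U (coord c A') \<otimes>\<^bsub>R\<^esub> h B A'))"
    by (rule tensor_form_coord_vf[OF h tf coord_vf_vect_hom R.one_graded])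
  also have "(\<Oplus>\<^bsub>R\<^esub>A'\<in>UNIV. ?k A' \<odot>\<^bsub>R\<^esub> (coord_vf M c A U (coord c A') \<otimes>\<^bsub>R\<^esub> h B A')) =
      (\<Oplus>\<^bsub>R\<^esub>A'\<in>UNIV. if A = A' then ?k A' \<odot>\<^bsub>R\<^esub> h B A' else \<zero>\<^bsub>R\<^esub>)"
    using hc by (intro R.finsum_cong'[OF refl]) (auto simp: coord_vf_coord)
  also have "\<dots> = ?k A \<odot>\<^bsub>R\<^esub> h B A"
    using hc by (intro R.finsum_singleton) auto
  also have "\<dots> = h A B"
  proof -
    have "h A B = koszul (idx_parity A) (idx_parity B) \<odot>\<^bsub>R\<^esub> h B A"
      using h unfolding metric_components_def by blast
    moreover have "koszul (idx_parity A) (idx_parity B) = ?k A" by (auto simp: koszul_def)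
    ultimately show ?thesis by simp
  qed
  finally show "component M g c A B = h A B" using hc by simp
qed

text \<open>This is g_\<tau>B + \<tau> g_tB = 0 with transposed indices, as the pairing formula
  produces them; the sign at \<open>h B None\<close> is the one from graded symmetry. Compatibility
  of \<open>g\<close> with restriction carries the vanishing of the global pairing to the
  chart.\<close>

lemma shander_relation:
  assumes h: "metric_components M c h" and tf: "tensor_form M g c h"
    and Q: "Q \<in> vect_hom M UNIV 1"
    and Q_kernel: "\<And>Y. Y \<in> vect M UNIV \<Longrightarrow> g UNIV Q Y = \<zero>\<^bsub>sections M UNIV\<^esub>"
    and g_restr: "\<And>X Y. X \<in> vect M UNIV \<Longrightarrow> Y \<in> vect M UNIV \<Longrightarrow>
      restr M UNIV U (g UNIV X Y) = g U (vf_normalise M U X) (vf_normalise M U Y)"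
    and Q_coord: "vf_normalise M U Q = vf_add M U (coord_vf M c None)
       (vf_smult M U (coord c None) (coord_vf M c (Some t)))"
  shows "koszul (idx_parity B) 1 \<odot>\<^bsub>R\<^esub> h B None \<oplus>\<^bsub>R\<^esub> coord c None \<otimes>\<^bsub>R\<^esub> h B (Some t) = \<zero>\<^bsub>R\<^esub>"
proof (rule zero_by_bumps)
  have hc: "h A A' \<in> carrier R" for A A'
    using h R.graded_closed unfolding metric_components_def by blast
  have cc: "coord c A \<in> carrier R" for A using R.graded_closed[OF coord_graded] .
  let ?k = "\<lambda>A :: 'n option. koszul (idx_parity B) (idx_parity A)" and ?Q = "vf_normalise M U Q"
  let ?S = "koszul (idx_parity B) 1 \<odot>\<^bsub>R\<^esub> h B None \<oplus>\<^bsub>R\<^esub> coord c None \<otimes>\<^bsub>R\<^esub> h B (Some t)"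
  show "?S \<in> carrier R" using hc cc by simp
  fix \<rho> K
  assume \<rho>: "\<rho> \<in> smooth_functions (chart_range c)" "compact K" "K \<subseteq> chart_range c"
    "\<And>x. x \<notin> K \<Longrightarrow> \<rho> x = 0"
  let ?f = "pb U (\<rho>, \<lambda>x. 0)"
  have f: "?f \<in> graded M U 0"
    by (rule pb_homD(6)[OF open_dom subset_refl])
      (use \<rho>(1) in \<open>simp add: model_graded_def chart_range_def\<close>)
  have fc: "?f \<in> carrier R" using R.graded_closed[OF f] .
  obtain Y where Y: "Y \<in> vect_hom M UNIV (idx_parity B)"
      "vf_normalise M U Y = vf_smult M U ?f (coord_vf M c B)"
    using extend_coord_vf[OF \<rho>] by blast
  have QU: "?Q \<in> vect_hom M U 1" by (rule vf_normalise_vect_hom[OF Q open_dom subset_UNIV])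
  \<comment> \<open>The coefficients of Q = \<partial>_\<tau> + \<tau> \<partial>_t; only the
    indices \<open>None\<close> and \<open>Some t\<close> survive in the sum over
    \<open>A\<close>.\<close>
  have Qc: "?Q U (coord c A) = (if A = None then \<one>\<^bsub>R\<^esub> else if A = Some t then coord c None else \<zero>\<^bsub>R\<^esub>)" for A
    unfolding Q_coord using cc
    by (auto simp: vf_add_def vf_smult_def vf_normalise_apply[OF open_dom subset_refl] coord_vf_coord restr_id[OF open_dom])
  let ?F = "\<lambda>A. ?k A \<odot>\<^bsub>R\<^esub> (?Q U (coord c A) \<otimes>\<^bsub>R\<^esub> h B A)"
  have Fc: "?F A \<in> carrier R" for A using hc cc by (simp add: Qc)
  have "(\<Oplus>\<^bsub>R\<^esub>A\<in>UNIV. ?F A) = (\<Oplus>\<^bsub>R\<^esub>A\<in>{None, Some t}. ?F A)"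
    using hc Fc by (intro R.add.finprod_mono_neutral_cong_right) (auto simp: Qc)
  also have "\<dots> = ?F None \<oplus>\<^bsub>R\<^esub> ?F (Some t)"
    using Fc by (simp add: R.finsum_insert)
  also have "\<dots> = ?S"
    using hc cc by (simp add: Qc idx_parity_def)
  finally have S: "(\<Oplus>\<^bsub>R\<^esub>A\<in>UNIV. ?F A) = ?S" .
  have "?f \<otimes>\<^bsub>R\<^esub> ?S = g U ?Q (vf_normalise M U Y)"
    unfolding Y(2) tensor_form_coord_vf[OF h tf QU f] S by (rule refl)
  also have "\<dots> = restr M UNIV U (g UNIV Q Y)"
    using g_restr[OF vect_hom_vect[OF open_UNIV Q] vect_hom_vect[OF open_UNIV Y(1)]] by simp
  also have "\<dots> = \<zero>\<^bsub>R\<^esub>"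
    using Q_kernel[OF vect_hom_vect[OF open_UNIV Y(1)]] restr_zero[OF open_UNIV open_dom] by simp
  finally show "?f \<otimes>\<^bsub>R\<^esub> ?S = \<zero>\<^bsub>R\<^esub>" .
qed

text \<open>With a single odd coordinate the even part of the model consists of the pairs with
  second entry 0, that is, of functions without a \<tau>-term.\<close>

lemma graded_even_coord_fun:
  assumes "s \<in> graded M U 0"
  shows "even_coord_fun c s"
proof -
  obtain \<phi> where "\<phi> \<in> model_graded (img U) 0" "s = pb U \<phi>"
    using pb_graded_cases[OF open_dom subset_refl assms] .
  then show ?thesis
    unfolding even_coord_fun_def by (auto simp: model_graded_def chart_range_def)
qed

end

section \<open>The component formulas in Shander coordinates\<close>

theorem proposition2p2:
  fixes M :: "('p::{t2_space, second_countable_topology}, 's) superspace"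
    and g :: "('p, 's) pairing"
    and Q P :: "('p, 's) vfield"
    and c :: "('p, 's, 'n::finite) chart"
    and t :: 'n
  assumes "super_null_riemannian TYPE('n) M g Q P"
    and "shander_chart M Q P c t"
  shows "let R = sections M (chart_dom c); \<tau> = coord c None; G = component M g c in
      tensor_form M g c G \<and>
      (\<forall>a b. a \<noteq> t \<and> b \<noteq> t \<longrightarrow>
         even_coord_fun c (G (Some a) (Some b)) \<and> G (Some a) (Some b) = G (Some b) (Some a)) \<and>
      (\<forall>a. a \<noteq> t \<longrightarrow>
         even_coord_fun c (G (Some t) (Some a)) \<and> G (Some t) (Some a) = G (Some a) (Some t)) \<and>
      even_coord_fun c (G (Some t) (Some t)) \<and>
      (\<forall>a. a \<noteq> t \<longrightarrow>
         G None (Some a) = \<ominus>\<^bsub>R\<^esub> (\<tau> \<otimes>\<^bsub>R\<^esub> G (Some t) (Some a)) \<and>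
         G (Some a) None = \<ominus>\<^bsub>R\<^esub> (\<tau> \<otimes>\<^bsub>R\<^esub> G (Some t) (Some a))) \<and>
      G None (Some t) = \<ominus>\<^bsub>R\<^esub> (\<tau> \<otimes>\<^bsub>R\<^esub> G (Some t) (Some t)) \<and>
      G (Some t) None = \<ominus>\<^bsub>R\<^esub> (\<tau> \<otimes>\<^bsub>R\<^esub> G (Some t) (Some t)) \<and>
      G None None = \<zero>\<^bsub>R\<^esub>"
proof -
  note snr = assms(1)[unfolded super_null_riemannian_def]
  note shander = assms(2)[unfolded shander_chart_def]
  have "supermanifold TYPE('n) M" using snr by (rule conjunct1)
  then have sheaf: "sheaf_of_superalgebras M" unfolding supermanifold_def by (rule conjunct1)
  have chart: "is_chart M c" using shander by (rule conjunct1)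
  interpret superspace_chart M c using sheaf chart by unfold_locales
  have metric: "metric TYPE('n) M g" using snr[THEN conjunct2] by (rule conjunct1)
  have Q: "Q \<in> vect_hom M UNIV 1" using snr[THEN conjunct2, THEN conjunct2, THEN conjunct2] by (rule conjunct1)
  have ker: "metric_kernel M g = {vf_smult M UNIV f Q | f. f \<in> carrier (sections M UNIV)}"
    using snr[THEN conjunct2, THEN conjunct2, THEN conjunct2, THEN conjunct2, THEN conjunct2,
        THEN conjunct2, THEN conjunct2] by (rule conjunct1)
  obtain h where h: "metric_components M c h" and tf: "tensor_form M g c h"
    using metric[unfolded metric_def, THEN conjunct2, THEN spec, THEN mp, OF chart] by (elim exE conjE)
  have G: "component M g c = h" by (rule component_eq[OF h tf])
  have "\<one>\<^bsub>sections M UNIV\<^esub> \<in> carrier (sections M UNIV)"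
  proof -
    interpret superalg "sections M UNIV" "graded M UNIV" by (rule superalg_sections[OF open_UNIV])
    show ?thesis by simp
  qed
  \<comment> \<open>\<open>Q\<close> is the multiple 1 Q of itself and so lies in its own
    span.\<close>
  then have "Q \<in> metric_kernel M g"
    unfolding ker mem_Collect_eq by (intro exI[of _ "\<one>\<^bsub>sections M UNIV\<^esub>"] conjI vf_smult_one[OF Q open_UNIV, symmetric])
  then have Q_kernel: "g UNIV Q Y = \<zero>\<^bsub>sections M UNIV\<^esub>" if "Y \<in> vect M UNIV" for Y
    using that by (simp add: metric_kernel_def)
  have g_restr: "restr M UNIV U (g UNIV X Y) = g U (vf_normalise M U X) (vf_normalise M U Y)"
    if XY: "X \<in> vect M UNIV" "Y \<in> vect M UNIV" for X Y
    using metric[unfolded metric_def, THEN conjunct1, THEN spec, THEN mp, OF open_UNIV, THEN bspec, OF XY(1),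
        THEN bspec, OF XY(2), THEN conjunct2, THEN conjunct2, THEN spec, THEN mp, of U] open_dom by simp
  have rel: "koszul (idx_parity B) 1 \<odot>\<^bsub>R\<^esub> h B None \<oplus>\<^bsub>R\<^esub> coord c None \<otimes>\<^bsub>R\<^esub> h B (Some t) = \<zero>\<^bsub>R\<^esub>" for B
    by (rule shander_relation[OF h tf Q _ _ shander[THEN conjunct2, THEN conjunct1]]) (fact Q_kernel g_restr)+
  have hg: "h A B \<in> graded M U (idx_parity A + idx_parity B)"
    and sym: "h A B = koszul (idx_parity A) (idx_parity B) \<odot>\<^bsub>R\<^esub> h B A" for A B
    by (rule h[unfolded metric_components_def, THEN spec, THEN spec, THEN conjunct1],
        rule h[unfolded metric_components_def, THEN spec, THEN spec, THEN conjunct2])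
  note hc = R.graded_closed[OF hg]
  have \<tau>: "coord c None \<in> carrier R" using R.graded_closed[OF coord_graded] .
  have even: "even_coord_fun c (h (Some a) (Some b))" for a b
    by (rule graded_even_coord_fun) (use hg[of "Some a" "Some b"] in \<open>simp add: idx_parity_def\<close>)
  have sym_even: "h (Some a) (Some b) = h (Some b) (Some a)" for a b
    using sym[of "Some a" "Some b", unfolded idx_parity_def option.case koszul_simps R.smult_real_one[OF hc]] .
  have sym_mixed: "h None (Some b) = h (Some b) None" for b
    using sym[of None "Some b", unfolded idx_parity_def option.case koszul_simps R.smult_real_one[OF hc]] .
  \<comment> \<open>Here \<open>b\<close> runs through all even indices: \<open>b = t\<close> gives
    g_\<tau>t, the others give g_\<tau>a.\<close>
  have mixed: "h (Some b) None = \<ominus>\<^bsub>R\<^esub> (coord c None \<otimes>\<^bsub>R\<^esub> h (Some t) (Some b))" for b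
  proof -
    have "h (Some b) None \<oplus>\<^bsub>R\<^esub> coord c None \<otimes>\<^bsub>R\<^esub> h (Some t) (Some b) = \<zero>\<^bsub>R\<^esub>"
      using rel[of "Some b", unfolded idx_parity_def option.case koszul_simps R.smult_real_one[OF hc] sym_even[of b t]] .
    then show ?thesis
      by (rule R.minus_equality[symmetric]) (use hc \<tau> in auto)
  qed
  \<comment> \<open>Two odd indices carry the sign -1, so this component equals its own negative.
    Doubling it gives 0, and the scalar 1/2 removes the factor.\<close>
  have "h None None = \<ominus>\<^bsub>R\<^esub> h None None"
    using sym[of None None, unfolded idx_parity_def option.case koszul_simps R.smult_real_minus_one[OF hc]] .
  then have "h None None \<oplus>\<^bsub>R\<^esub> h None None = h None None \<oplus>\<^bsub>R\<^esub> \<ominus>\<^bsub>R\<^esub> h None None"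
    by (rule arg_cong)
  also have "\<dots> = \<zero>\<^bsub>R\<^esub>" using R.r_neg[OF hc] .
  finally have "h None None \<oplus>\<^bsub>R\<^esub> h None None = \<zero>\<^bsub>R\<^esub>" .
  then have "(1 + 1) \<odot>\<^bsub>R\<^esub> h None None = \<zero>\<^bsub>R\<^esub>"
    using hc by (simp only: R.smult_real_add_left R.smult_real_one)
  then have "(1 / 2) \<odot>\<^bsub>R\<^esub> ((1 + 1) \<odot>\<^bsub>R\<^esub> h None None) = \<zero>\<^bsub>R\<^esub>"
    by simp
  then have odd: "h None None = \<zero>\<^bsub>R\<^esub>"
    using hc by (simp add: R.smult_real_assoc)
  show ?thesis
    unfolding Let_def G sym_mixed
    by (intro conjI allI impI tf even sym_even mixed odd)
qed

end
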